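(* Let $S=\{a_n\}_{n\in\mathbb N}$ be a sequence of complex numbers satisfying (i)–(iii) of the context, with exponent of convergence $\alpha$, let $F$ be a characteristic function of $S$ of minimal growth order, and assume that a holomorphic branch of $\ln F$ in the sector $\mathcal I_\varepsilon^c$ satisfies (with $M=1$) $$\ln F(z)=\sum_{j=0}^N\sum_{k=0}^1 d_{j,k}\,z^{\alpha-(j/m)}\ln^k z+o\big(z^{\alpha-(N/m)-\delta}\big),\qquad z\to\infty,\ z\in\mathcal I_\varepsilon^c,$$ for some nonnegative integer $N$, some integer $m\ge1$ and some $\delta>0$ with $N/m>\alpha-\delta$. Then (the analytic continuation of) $\zeta_S(s)$ is regular at $s=0$ and $$\zeta_S'(0)=\begin{cases}-\ln F(0),&\text{if }\alpha-(j/m)\ne0\text{ for all }j\in\{0,1,\dots,N\},\\ i\pi d_{j',1}+d_{j',0}-\ln F(0),&\text{if }\alpha-(j'/m)=0\text{ for some }j'\in\{0,1,\dots,N\}.\end{cases}$$ In particular, $\zeta_S'(0)=i\pi\zeta_S(0)+d_{j',0}-\ln F(0)$, where $d_{j',0}=0$ in the first case.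
   Context: Assumptions on $S=\{a_n\}_{n\in\mathbb N}\subset\mathbb C$: (i) $0<|a_1|\le|a_2|\le\dots\to\infty$; (ii) $\alpha=\limsup_{n\to\infty}(\ln n)/(\ln|a_n|)$ is finite; (iii) there exist $\varepsilon>0$ and $\Psi\in[-\pi,\pi)$ such that all $a_n\in\mathcal I_\varepsilon=\{z\in\mathbb C:\operatorname{Arg}(z)\notin(\Psi-\varepsilon,\Psi+\varepsilon)\}$ (arguments modulo $2\pi$); $\mathcal I_\varepsilon^c$ is the complementary sector around the ray $R_\Psi=\{te^{i\Psi}:t\ge0\}$. The $\zeta$-function is $\zeta_S(s)=\sum_{n=1}^\infty a_n^{-s}$ for $\Re(s)>\alpha$, with branch cut along $R_\Psi$: $z^{-s}=\exp(-s(\ln|z|+i\theta))$, $\theta\in(\Psi-2\pi,\Psi)$ being the argument of $z$; under the stated expansion it continues meromorphically to $\Re(s)>\alpha-(N/m)-\delta$. A characteristic function of $S$ of minimal growth order is an entire function $F=e^{\omega}H$ with $\omega$ a polynomial of degree at most $\lfloor\alpha\rfloor$ and $H(z)=\prod_{n=1}^{\infty}(1-z/a_n)\exp\big[\sum_{j=1}^{\lfloor\alpha\rfloor}\frac1j(z/a_n)^j\big]$. In the asymptotic expansion, for $z\in\mathcal I_\varepsilon^c$, $\ln z=\ln|z|+i\theta$ with $\theta\in(\Psi-\varepsilon,\Psi+\varepsilon)$ the argument of $z$, and $z^\beta=e^{\beta\ln z}$. The symbol $\ln F(0)$ denotes the limit, as $z\to0$ inside $\mathcal I_\varepsilon^c$,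 of the chosen holomorphic branch of $\ln F(z)$ (the one satisfying the expansion). *)

theory Defs
  imports "HOL-Complex_Analysis.Complex_Analysis" "HOL-Library.Landau_Symbols"
begin

text \<open>
  The argument of \<open>z \<noteq> 0\<close> lying in the window \<open>(c - pi, c + pi]\<close>, i.e. centred at \<open>c\<close>, and the
  associated branches of logarithm and power, cut along the ray opposite to direction \<open>c\<close>.
  Two centres are used for a ray of direction \<open>\<Psi>\<close>: the centre \<open>\<Psi> - pi\<close> gives arguments in
  \<open>(\<Psi> - 2 pi, \<Psi>)\<close> off the ray (the branch cut along the ray, used in the zeta function), and the
  centre \<open>\<Psi>\<close> gives the arguments near \<open>\<Psi>\<close> (used in the asymptotic expansion around the ray).
\<close>

definition arg_near :: "real \<Rightarrow> complex \<Rightarrow> real" where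
  "arg_near c z = c + Arg (z / cis c)"

definition ln_near :: "real \<Rightarrow> complex \<Rightarrow> complex" where
  "ln_near c z = of_real (ln (norm z)) + \<i> * of_real (arg_near c z)"

definition powr_near :: "real \<Rightarrow> complex \<Rightarrow> complex \<Rightarrow> complex" where
  "powr_near c z s = exp (s * ln_near c z)"

lemma is_Arg_arg_near:
  assumes "z \<noteq> 0"
  shows "is_Arg z (arg_near c z)"
proof -
  have "is_Arg (z / cis c) (Arg (z / cis c))"
    using assms by (intro is_Arg_Arg) auto
  hence "z / cis c = of_real (norm z) * cis (Arg (z / cis c))"
    by (simp add: is_Arg_def norm_divide cis_conv_exp)
  hence "z = of_real (norm z) * (cis (Arg (z / cis c)) * cis c)"
    by (simp add: field_simps)
  thus ?thesis
    by (simp only: is_Arg_def arg_near_def cis_mult add.commute flip: cis_conv_exp)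
qed

lemma arg_near_bounds: "c - pi < arg_near c z" "arg_near c z \<le> c + pi"
  using mpi_less_Arg[of "z / cis c"] Arg_le_pi[of "z / cis c"] by (auto simp: arg_near_def)

lemma arg_near_unique:
  assumes "z \<noteq> 0" "is_Arg z \<theta>" "c - pi < \<theta>" "\<theta> \<le> c + pi"
  shows "arg_near c z = \<theta>"
proof -
  have "z / cis c = of_real (norm z) * (cis \<theta> / cis c)"
    using assms(2) by (simp add: is_Arg_def flip: cis_conv_exp)
  also have "\<dots> = of_real (norm z) * exp (\<i> * of_real (\<theta> - c))"
    by (simp add: cis_divide cis_conv_exp[of "\<theta> - c"] del: of_real_diff)
  finally have "Arg (z / cis c) = \<theta> - c"
    using assms by (intro Arg_unique[where r = "norm z"]) auto
  thus ?thesis by (simp add: arg_near_def)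
qed

lemma exp_ln_near: "z \<noteq> 0 \<Longrightarrow> exp (ln_near c z) = z"
  using is_Arg_arg_near[of z c]
  by (simp add: ln_near_def exp_add is_Arg_def exp_of_real)

text \<open>
  The open sector of half-angle \<open>\<epsilon>\<close> around the ray of direction \<open>\<Psi>\<close>, without its vertex;
  \<^const>\<open>is_Arg\<close> allows every argument of \<open>z\<close>, so the condition is modulo \<open>2 pi\<close>.
\<close>

definition sector :: "real \<Rightarrow> real \<Rightarrow> complex set" where
  "sector \<Psi> \<epsilon> = {z. z \<noteq> 0 \<and> (\<exists>\<theta>. \<Psi> - \<epsilon> < \<theta> \<and> \<theta> < \<Psi> + \<epsilon> \<and> is_Arg z \<theta>)}"

text \<open>
  Sequences \<open>a 1, a 2, \<dots>\<close> are functions on \<^typ>\<open>nat\<close> whose value at \<open>0\<close> is ignored; hence the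
  shift by \<open>Suc\<close> in series and products. The quotient of logarithms below can be ill-defined only
  for the finitely many \<open>n\<close> with \<open>norm (a n) \<le> 1\<close>, which do not affect the limit superior.
\<close>

definition exponent_of_convergence :: "(nat \<Rightarrow> complex) \<Rightarrow> ereal" where
  "exponent_of_convergence a = limsup (\<lambda>n. ereal (ln (real n) / ln (norm (a n))))"

definition admissible_sequence :: "(nat \<Rightarrow> complex) \<Rightarrow> real \<Rightarrow> real \<Rightarrow> real \<Rightarrow> bool" where
  "admissible_sequence a \<alpha> \<Psi> \<epsilon> \<longleftrightarrow>
     0 < norm (a 1) \<and>
     (\<forall>n\<ge>1. norm (a n) \<le> norm (a (Suc n))) \<and>
     filterlim (\<lambda>n. norm (a n)) at_top sequentially \<and>
     exponent_of_convergence a = ereal \<alpha> \<and>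
     0 < \<epsilon> \<and> -pi \<le> \<Psi> \<and> \<Psi> < pi \<and>
     (\<forall>n\<ge>1. a n \<notin> sector \<Psi> \<epsilon>)"

definition canonical_product :: "(nat \<Rightarrow> complex) \<Rightarrow> real \<Rightarrow> complex \<Rightarrow> complex" where
  "canonical_product a \<alpha> z = (\<Prod>n. weierstrass_factor (nat \<lfloor>\<alpha>\<rfloor>) (z / a (Suc n)))"

definition minimal_characteristic_function ::
    "(nat \<Rightarrow> complex) \<Rightarrow> real \<Rightarrow> (complex \<Rightarrow> complex) \<Rightarrow> bool" where
  "minimal_characteristic_function a \<alpha> F \<longleftrightarrow>
     (\<exists>\<omega> :: complex poly. degree \<omega> \<le> nat \<lfloor>\<alpha>\<rfloor> \<and>
        F = (\<lambda>z. exp (poly \<omega> z) * canonical_product a \<alpha> z))"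

definition zeta_series :: "(nat \<Rightarrow> complex) \<Rightarrow> real \<Rightarrow> complex \<Rightarrow> complex" where
  "zeta_series a \<Psi> s = (\<Sum>n. powr_near (\<Psi> - pi) (a (Suc n)) (- s))"

text \<open>
  \<open>Z\<close> is the meromorphic continuation of the zeta function from \<open>Re s > \<alpha>\<close> to \<open>Re s > \<sigma>\<close>.
  Requiring \<^const>\<open>nicely_meromorphic_on\<close> (no removable singularities left, value \<open>0\<close> at poles)
  makes the values of \<open>Z\<close> on this half-plane, hence regularity at a point, unambiguous.
\<close>

definition zeta_continuation ::
    "(nat \<Rightarrow> complex) \<Rightarrow> real \<Rightarrow> real \<Rightarrow> real \<Rightarrow> (complex \<Rightarrow> complex) \<Rightarrow> bool" where
  "zeta_continuation a \<alpha> \<Psi> \<sigma> Z \<longleftrightarrow>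
     Z nicely_meromorphic_on {s. \<sigma> < Re s} \<and>
     (\<forall>s. \<alpha> < Re s \<longrightarrow> Z s = zeta_series a \<Psi> s)"

end

theory Submission
  imports Defs "HOL-Real_Asymp.Real_Asymp"
begin

text \<open>
  Write \<open>p\<close> for the integer part of \<open>\<alpha>\<close> and \<open>b n = exp (\<i> \<Psi>) / a (n + 1)\<close>. On the ray \<open>z = t exp (\<i> \<Psi>)\<close>
  the chosen branch of the logarithm is \<open>ln F z = C + \<omega> z + h t\<close>, where \<open>C\<close> is a constant and
  \<open>h t\<close> is the sum over \<open>n\<close> of the logarithms of the Weierstrass factors of genus \<open>p\<close> at
  \<open>t * b n\<close> (lemma \<open>log_branch_eq\<close>); each of these logarithms vanishes at \<open>t = 0\<close>, so
  \<open>ln F 0 = C + \<omega> 0\<close>.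

  The zeta function is a Mellin transform of \<open>h\<close>. For a single factor,
  \<open>\<integral> t^(-s-1) log E\<^sub>p (-t w) dt = \<pi> / (s sin (\<pi> s)) * w^s\<close> whenever \<open>p < s < p + 1\<close> and \<open>w\<close> is not a
  real number \<open>\<le> 0\<close> (lemma \<open>mellin_log_weierstrass\<close>: integration by parts and the Beta integral for
  \<open>w = 1\<close>, then scaling, then the identity theorem in \<open>w\<close>). Taking \<open>w = - b n\<close> and summing over \<open>n\<close>
  gives, for \<open>\<alpha> < s < p + 1\<close>,
  \<open>\<zeta>(s) = s sin (\<pi> s) / \<pi> * exp (-\<i> (\<Psi> - \<pi>) s) * M(s)\<close> with \<open>M(s) = \<integral> t^(-s-1) h t dt\<close>
  (lemma \<open>mellin_log_product_ray\<close>). The factor \<open>exp (-\<i> (\<Psi> - \<pi>) s)\<close> compares the principal branch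
  at \<open>- b n\<close> with the branch of \<open>a (n + 1)^(-s)\<close> cut along the ray.

  The expansion of \<open>ln F\<close> at infinity continues \<open>M\<close> to the left: on \<open>t > 1\<close> a term
  \<open>t^\<beta> (A + B ln t)\<close> of \<open>h\<close> has the transform \<open>A / (s - \<beta>) + B / (s - \<beta>)\<^sup>2\<close>, the error term
  \<open>o(t^\<sigma>)\<close> with \<open>\<sigma> = \<alpha> - N/m - \<delta> < 0\<close> and the integral over \<open>t < 1\<close> are holomorphic in
  \<open>\<sigma> < Re s < p + 1\<close>.

  At \<open>s = 0\<close> the prefactor has the double zero \<open>s\<^sup>2 (1 - \<i> (\<Psi> - \<pi>) s + \<dots>)\<close>, so only the polar part
  of \<open>M\<close> at \<open>0\<close> matters. It is \<open>D\<^sub>1 / s\<^sup>2 + D\<^sub>0 / s\<close> with \<open>D\<^sub>1 = d j' 1\<close> and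
  \<open>D\<^sub>0 = d j' 0 + \<i> \<Psi> d j' 1 - ln F 0\<close>, the \<open>\<i> \<Psi>\<close> coming from \<open>ln z = ln t + \<i> \<Psi>\<close>
  and the \<open>- ln F 0\<close> from the constant \<open>C + \<omega> 0\<close> subtracted in \<open>h\<close> (lemma
  \<open>double_pole_times_double_zero\<close>); if no exponent of the expansion is \<open>0\<close>, the terms with \<open>j'\<close> are
  missing. Hence \<open>\<zeta>(0) = D\<^sub>1\<close> and
  \<open>\<zeta>'(0) = D\<^sub>0 - \<i> (\<Psi> - \<pi>) D\<^sub>1 = \<i> \<pi> d j' 1 + d j' 0 - ln F 0\<close>: the direction \<open>\<Psi>\<close> cancels.
\<close>

section \<open>Holomorphic functions from integrals and from real values\<close>

text \<open>
  Differentiation under the integral sign. By Cauchy's estimate a local integrable bound on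
  the integrand also bounds its derivative, hence its difference quotients, and dominated
  convergence applies to these. The lemma serves for Mellin integrals as functions of the exponent
  and of the scaling factor, and, over the counting measure, for the zeta series.
\<close>

lemma holomorphic_integral:
  fixes f :: "'a \<Rightarrow> complex \<Rightarrow> complex"
  assumes U: "open U"
    and meas: "\<And>z. z \<in> U \<Longrightarrow> (\<lambda>x. f x z) \<in> borel_measurable M"
    and hol: "\<And>x. x \<in> space M \<Longrightarrow> f x holomorphic_on U"
    and dom: "\<And>z0. z0 \<in> U \<Longrightarrow>
      \<exists>r>0. \<exists>g. integrable M g \<and> (\<forall>x\<in>space M. \<forall>z\<in>ball z0 r. z \<in> U \<longrightarrow> norm (f x z) \<le> g x)"
  shows "(\<lambda>z. LINT x|M. f x z) holomorphic_on U"
proof -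
  have "(\<lambda>z. LINT x|M. f x z) field_differentiable (at z0)" if z0: "z0 \<in> U" for z0
  proof -
    obtain r0 g where r0: "r0 > 0" and g: "integrable M g"
      and bnd: "\<And>x z. x \<in> space M \<Longrightarrow> z \<in> ball z0 r0 \<Longrightarrow> z \<in> U \<Longrightarrow> norm (f x z) \<le> g x"
      using dom[OF z0] by blast
    obtain r1 where r1: "r1 > 0" "cball z0 r1 \<subseteq> U"
      using U z0 open_contains_cball by blast
    \<comment> \<open>every disc of radius \<open>r\<close> about a point of \<open>ball z0 r\<close> stays where the bound \<open>g\<close> holds\<close>
    define r where "r = min (r0/2) r1 / 2"
    have r: "r > 0" using r0 r1 by (simp add: r_def)
    have sub: "z \<in> U \<and> z \<in> ball z0 r0" if "dist z0 z \<le> 2 * r" for z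
    proof -
      have "2 * r \<le> r1" "2 * r < r0" using r0 r1 by (auto simp: r_def)
      thus ?thesis using that r1(2) by (auto simp: subset_iff)
    qed
    have lip: "norm (f x z - f x z0) \<le> g x / r * norm (z - z0)"
      if x: "x \<in> space M" and z: "z \<in> ball z0 r" for x z
    proof (rule field_differentiable_bound[where S = "ball z0 r" and f' = "deriv (f x)"])
      fix w assume w: "w \<in> ball z0 r"
      have ws: "cball w r \<subseteq> U"
      proof
        fix v assume "v \<in> cball w r"
        hence "dist z0 v \<le> 2 * r"
          using dist_triangle[of z0 v w] w by auto
        thus "v \<in> U" using sub by blast
      qed
      have hx: "f x holomorphic_on U" using hol x by blast
      have wU: "w \<in> U" using ws r by auto
      show "(f x has_field_derivative deriv (f x) w) (at w within ball z0 r)"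
        using hx wU U holomorphic_derivI by blast
      have "norm ((deriv ^^ 1) (f x) w) \<le> fact 1 * g x / r ^ 1"
      proof (rule Cauchy_inequality)
        show "f x holomorphic_on ball w r"
          using hx ws by (meson ball_subset_cball holomorphic_on_subset)
        show "continuous_on (cball w r) (f x)"
          using hx ws by (meson holomorphic_on_imp_continuous_on holomorphic_on_subset)
        fix v assume v: "norm (w - v) = r"
        hence "dist z0 v \<le> 2 * r"
          using dist_triangle[of z0 v w] w by (auto simp: dist_norm)
        thus "norm (f x v) \<le> g x" using bnd[OF x] sub by blast
      qed (use r in auto)
      thus "norm (deriv (f x) w) \<le> g x / r" by simp
    qed (use z r in auto)
    have lim: "((\<lambda>z. LINT x|M. (f x z - f x z0) / (z - z0)) \<longlongrightarrow> (LINT x|M. deriv (f x) z0)) (at z0)"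
      unfolding tendsto_at_iff_sequentially
    proof (intro allI impI)
      fix X :: "nat \<Rightarrow> complex" assume X: "\<forall>i. X i \<in> UNIV - {z0}" "X \<longlonglongrightarrow> z0"
      have "\<forall>\<^sub>F n in sequentially. X n \<in> ball z0 r"
        using X(2) r by (auto simp: tendsto_iff dist_commute)
      then obtain n0 where n0: "\<And>n. n \<ge> n0 \<Longrightarrow> X n \<in> ball z0 r"
        by (auto simp: eventually_sequentially)
      define Y where "Y n = X (n + n0)" for n
      have Y: "Y n \<in> ball z0 r" "Y n \<noteq> z0" "Y n \<in> U" for n
        using n0[of "n + n0"] X(1) sub[of "Y n"] r by (auto simp: Y_def)
      have YX: "Y \<longlonglongrightarrow> z0" unfolding Y_def using X(2) by (rule LIMSEQ_ignore_initial_segment)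
      have pt: "(\<lambda>n. (f x (Y n) - f x z0) / (Y n - z0)) \<longlonglongrightarrow> deriv (f x) z0"
        if x: "x \<in> space M" for x
      proof -
        have "(f x has_field_derivative deriv (f x) z0) (at z0)"
          using hol[OF x] U z0 by (rule holomorphic_derivI)
        hence "((\<lambda>z. (f x z - f x z0) / (z - z0)) \<longlongrightarrow> deriv (f x) z0) (at z0)"
          by (simp add: has_field_derivative_iff)
        thus ?thesis using YX Y(2) unfolding tendsto_at_iff_sequentially o_def by blast
      qed
      have m1: "(\<lambda>x. (f x (Y n) - f x z0) / (Y n - z0)) \<in> borel_measurable M" for n
        using meas[OF Y(3)[of n]] meas[OF z0] by measurable
      have "(\<lambda>n. LINT x|M. (f x (Y n) - f x z0) / (Y n - z0)) \<longlonglongrightarrow> (LINT x|M. deriv (f x) z0)"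
      proof (rule integral_dominated_convergence[where w = "\<lambda>x. g x / r"])
        show "(\<lambda>x. deriv (f x) z0) \<in> borel_measurable M"
          by (rule borel_measurable_LIMSEQ_metric[OF m1 pt])
        show "integrable M (\<lambda>x. g x / r)" using g by simp
        show "AE x in M. norm ((f x (Y n) - f x z0) / (Y n - z0)) \<le> g x / r" for n
          using lip[OF _ Y(1)[of n]] Y(2)[of n]
          by (intro AE_I2) (auto simp: norm_divide divide_simps mult_ac)
      qed (use pt m1 in auto)
      hence "(\<lambda>n. (\<lambda>z. LINT x|M. (f x z - f x z0) / (z - z0)) (X (n + n0))) \<longlonglongrightarrow> (LINT x|M. deriv (f x) z0)"
        by (simp add: Y_def)
      thus "((\<lambda>z. LINT x|M. (f x z - f x z0) / (z - z0)) \<circ> X) \<longlonglongrightarrow> (LINT x|M. deriv (f x) z0)"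
        unfolding o_def by (rule LIMSEQ_offset)
    qed
    have int: "integrable M (\<lambda>x. f x z)" if "z \<in> ball z0 r" for z
    proof (rule Bochner_Integration.integrable_bound[OF g])
      have z: "z \<in> U \<and> z \<in> ball z0 r0" using that sub[of z] r by auto
      show "(\<lambda>x. f x z) \<in> borel_measurable M" using meas z by blast
      show "AE x in M. norm (f x z) \<le> norm (g x)"
        using bnd z by (intro AE_I2) force
    qed
    have "((\<lambda>z. ((LINT x|M. f x z) - (LINT x|M. f x z0)) / (z - z0)) \<longlongrightarrow> (LINT x|M. deriv (f x) z0)) (at z0)"
    proof (rule Lim_transform_eventually[OF lim])
      have "\<forall>\<^sub>F z in at z0. z \<in> ball z0 r" using r by (intro eventually_at_in_open') auto
      thus "\<forall>\<^sub>F z in at z0. (LINT x|M. (f x z - f x z0) / (z - z0)) = ((LINT x|M. f x z) - (LINT x|M. f x z0)) / (z - z0)"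
        by eventually_elim (use int r in \<open>simp add: Bochner_Integration.integral_diff\<close>)
    qed
    thus ?thesis
      unfolding field_differentiable_def has_field_derivative_iff by blast
  qed
  thus ?thesis using U by (simp add: holomorphic_on_open field_differentiable_def)
qed

text \<open>
  All explicit evaluations below are made at real points only; this identity theorem
  carries them over to complex ones.
\<close>

lemma holomorphic_eq_if_eq_on_real_interval:
  assumes "f holomorphic_on S" "g holomorphic_on S" "open S" "connected S" "a < b"
    and "\<And>x::real. a < x \<Longrightarrow> x < b \<Longrightarrow> of_real x \<in> S"
    and "\<And>x::real. a < x \<Longrightarrow> x < b \<Longrightarrow> f (of_real x) = g (of_real x)"
    and "z \<in> S"
  shows "f z = (g z :: complex)"
proof -
  define m where "m = (a + b) / 2"
  have m: "a < m" "m < b" using \<open>a < b\<close> by (auto simp: m_def)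
  have "f z - g z = 0"
  proof (rule analytic_continuation[where f = "\<lambda>z. f z - g z" and S = S and U = "of_real ` {a<..<b}" and \<xi> = "of_real m"])
    show "(\<lambda>z. f z - g z) holomorphic_on S" using assms by (intro holomorphic_intros)
    show "complex_of_real m islimpt of_real ` {a<..<b}"
      unfolding islimpt_approachable
    proof (intro allI impI)
      fix e :: real assume e: "e > 0"
      define x where "x = m + min (e / 2) ((b - m) / 2)"
      have "x \<in> {a<..<b}" "x \<noteq> m" "dist x m < e"
        using m e by (auto simp: x_def dist_norm min_def field_simps)
      thus "\<exists>x'\<in>complex_of_real ` {a<..<b}. x' \<noteq> of_real m \<and> dist x' (of_real m) < e"
        by (intro bexI[of _ "of_real x"]) (auto simp: dist_of_real)
    qed
  qed (use assms m in auto)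
  thus ?thesis by simp
qed

text \<open>
  Identity theorem for meromorphic functions. Values at single points carry no information
  here, hence the formulation by punctured neighbourhoods.
\<close>

lemma meromorphic_eventually_eq:
  assumes "f meromorphic_on S" "g meromorphic_on S" "open S" "connected S" "x \<in> S" "y \<in> S"
    and "\<forall>\<^sub>F z in at y. f z = g z"
  shows "\<forall>\<^sub>F z in at x. f z = g z"
proof -
  have "(\<lambda>z. f z - g z) meromorphic_on S" using assms by (intro meromorphic_intros)
  hence "(\<forall>\<^sub>\<approx>z\<in>S. f z - g z = 0) \<or> (\<forall>\<^sub>\<approx>z\<in>S. f z - g z \<noteq> 0)"
    using assms by (intro meromorphic_imp_constant_or_avoid)
  thus ?thesis
  proof
    assume "\<forall>\<^sub>\<approx>z\<in>S. f z - g z = 0"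
    from eventually_cosparse_imp_eventually_at[OF this \<open>x \<in> S\<close>, of UNIV] show ?thesis by simp
  next
    assume "\<forall>\<^sub>\<approx>z\<in>S. f z - g z \<noteq> 0"
    from eventually_cosparse_imp_eventually_at[OF this \<open>y \<in> S\<close>, of UNIV] assms(7)
    have "\<forall>\<^sub>F z in at y. False" by eventually_elim simp
    thus ?thesis by simp
  qed
qed

section \<open>Logarithms of Weierstrass factors\<close>

text \<open>
  The principal logarithm of \<open>1 - w\<close> together with the exponent of the Weierstrass factor. It
  is the branch of the logarithm of \<^term>\<open>weierstrass_factor p w\<close> that vanishes at \<open>0\<close>, holomorphic
  off the ray \<open>w \<ge> 1\<close>.
\<close>

definition log_weierstrass :: "nat \<Rightarrow> complex \<Rightarrow> complex" where
  "log_weierstrass p w = Ln (1 - w) + (\<Sum>j=1..p. w ^ j / of_nat j)"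

lemma log_weierstrass_0 [simp]: "log_weierstrass p 0 = 0"
  by (simp add: log_weierstrass_def power_0_left)

lemma exp_log_weierstrass: "w \<noteq> 1 \<Longrightarrow> exp (log_weierstrass p w) = weierstrass_factor p w"
  by (simp add: log_weierstrass_def weierstrass_factor_def exp_add)

text \<open>
  The polynomial part is the Taylor polynomial of \<open>- ln (1 - w)\<close>, so its derivative is a
  geometric sum that cancels all but the last term of \<open>-1 / (1 - w)\<close>.
\<close>

lemma has_field_derivative_log_weierstrass:
  assumes "1 - w \<notin> \<real>\<^sub>\<le>\<^sub>0"
  shows "(log_weierstrass p has_field_derivative - (w ^ p / (1 - w))) (at w)"
proof -
  have w: "1 - w \<noteq> 0" using assms by auto
  have "(log_weierstrass p has_field_derivative
          inverse (1 - w) * (0 - 1) + (\<Sum>j=1..p. of_nat j * w ^ (j - 1) * 1 / of_nat j)) (at w)"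
    unfolding log_weierstrass_def by (rule derivative_eq_intros refl assms | simp)+
  also have "(\<Sum>j=1..p. of_nat j * w ^ (j - 1) * 1 / of_nat j) = (\<Sum>j=1..p. w ^ (j - 1))"
    by (intro sum.cong) auto
  also have "\<dots> = (\<Sum>j<p. w ^ j)"
    by (rule sum.reindex_bij_witness[where i = Suc and j = "\<lambda>j. j - 1"]) auto
  also have "\<dots> = (1 - w ^ p) / (1 - w)"
    using w by (subst geometric_sum) (auto simp: field_simps)
  also have "inverse (1 - w) * (0 - 1) + (1 - w ^ p) / (1 - w) = - (w ^ p / (1 - w))"
    by (simp add: divide_inverse algebra_simps)
  finally show ?thesis .
qed

lemma not_nonpos_Reals_if_segment_nonzero:
  fixes w :: complex
  assumes "\<And>u. 0 \<le> u \<Longrightarrow> u \<le> 1 \<Longrightarrow> 1 - of_real u * w \<noteq> 0"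
  shows "1 - w \<notin> \<real>\<^sub>\<le>\<^sub>0"
proof
  assume "1 - w \<in> \<real>\<^sub>\<le>\<^sub>0"
  then obtain x where x: "x \<le> 0" "1 - w = of_real x" by (auto elim: nonpos_Reals_cases)
  hence w: "w = of_real (1 - x)" by (simp add: algebra_simps)
  have "1 - of_real (1 / (1 - x)) * w = 0"
    unfolding w of_real_mult[symmetric] using x by (simp del: of_real_diff)
  moreover have "0 \<le> 1 / (1 - x)" "1 / (1 - x) \<le> 1" using x by auto
  ultimately show False using assms[of "1 / (1 - x)"] by simp
qed

text \<open>
  One estimate covers small and large \<open>w\<close>: the exponent \<open>\<rho>\<close> may be taken \<open>p + 1\<close>
  near \<open>0\<close> and close to \<open>p\<close> near infinity. Along the segment \<open>u w\<close> the derivative has norm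
  at most \<open>\<bar>w\<bar> (u \<bar>w\<bar>)^p / (c (1 + u \<bar>w\<bar>))\<close>, and since \<open>x^(p + 1 - \<rho>) \<le> 1 + x\<close> this is dominated by
  the derivative of \<open>u^\<rho> \<bar>w\<bar>^\<rho> / (c \<rho>)\<close>.
\<close>

lemma norm_log_weierstrass_le:
  assumes c: "c > 0" and seg: "\<And>u. 0 \<le> u \<Longrightarrow> u \<le> 1 \<Longrightarrow> norm (1 - of_real u * w) \<ge> c * (1 + u * norm w)"
    and \<rho>: "real p < \<rho>" "\<rho> \<le> real p + 1"
  shows "norm (log_weierstrass p w) \<le> norm w powr \<rho> / (c * \<rho>)"
proof (cases "w = 0")
  case False
  have \<rho>0: "\<rho> > 0" using \<rho> by linarith
  have nz: "1 - of_real u * w \<noteq> 0" if "0 \<le> u" "u \<le> 1" for u :: real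
  proof -
    have "0 < c * (1 + u * norm w)" using c that by (intro mult_pos_pos add_pos_nonneg) auto
    thus ?thesis using seg[OF that] by auto
  qed
  have nn: "1 - of_real u * w \<notin> \<real>\<^sub>\<le>\<^sub>0" if "0 \<le> u" "u \<le> 1" for u :: real
  proof (rule not_nonpos_Reals_if_segment_nonzero)
    fix v :: real assume v: "0 \<le> v" "v \<le> 1"
    have "v * u \<le> 1" using v that by (simp add: mult_le_one)
    thus "1 - of_real v * (of_real u * w) \<noteq> 0"
      using nz[of "v * u"] v that by (simp add: mult.assoc)
  qed
  define f where "f u = log_weierstrass p (of_real u * w)" for u :: real
  define f' where "f' u = - ((of_real u * w) ^ p / (1 - of_real u * w)) * w" for u :: real
  define \<phi> where "\<phi> u = norm w powr \<rho> * u powr \<rho> / (c * \<rho>)" for u :: real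
  define \<phi>' where "\<phi>' u = norm w powr \<rho> * u powr (\<rho> - 1) / c" for u :: real
  have df: "(f has_vector_derivative f' u) (at u)" if "0 \<le> u" "u \<le> 1" for u
  proof -
    have "((\<lambda>u. of_real u * w) has_vector_derivative w) (at u)"
      by (auto intro!: derivative_eq_intros)
    from field_vector_diff_chain_at[OF this has_field_derivative_log_weierstrass[OF nn[OF that]]]
    show ?thesis unfolding f_def f'_def o_def by (simp add: mult.commute)
  qed
  have "norm (f 1 - f 0) \<le> \<phi> 1 - \<phi> 0"
  proof (rule differentiable_bound_general[where f' = f' and \<phi>' = \<phi>'])
    show "continuous_on {0..1} f"
      using df by (intro continuous_at_imp_continuous_on ballI has_vector_derivative_continuous) auto
    show "continuous_on {0..1} \<phi>"
      unfolding \<phi>_def using \<rho>0 c by (auto intro!: continuous_intros continuous_on_powr')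
    fix u :: real assume u: "0 < u" "u < 1"
    show "(f has_vector_derivative f' u) (at u)" using df u by auto
    show "(\<phi> has_vector_derivative \<phi>' u) (at u)"
      unfolding \<phi>_def \<phi>'_def has_real_derivative_iff_has_vector_derivative[symmetric]
      using u \<rho>0 c by (auto intro!: derivative_eq_intros simp: field_simps)
    define x where "x = u * norm w"
    have x: "x > 0" using u False by (simp add: x_def)
    have e: "x powr (real p + 1 - \<rho>) \<le> 1 + x"
    proof (cases "x \<le> 1")
      case True
      thus ?thesis using x \<rho> by (smt (verit) powr_le1)
    next
      case F: False
      hence "x powr (real p + 1 - \<rho>) \<le> x powr 1" using \<rho> by (intro powr_mono) auto
      thus ?thesis using x by simp
    qed
    have "norm (f' u) = x ^ p / norm (1 - of_real u * w) * norm w"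
      using u by (simp add: f'_def x_def norm_mult norm_divide norm_power)
    also have "\<dots> \<le> x ^ p / (c * (1 + x)) * norm w"
    proof (intro mult_right_mono divide_left_mono mult_pos_pos)
      show "c * (1 + x) \<le> norm (1 - of_real u * w)" using seg[of u] u by (simp add: x_def)
      show "norm (1 - of_real u * w) > 0" using nz[of u] u by simp
    qed (use c x in auto)
    also have "\<dots> \<le> x powr (\<rho> - 1) / c * norm w"
    proof -
      have "x ^ p = x powr (\<rho> - 1) * x powr (real p + 1 - \<rho>)"
        using x by (simp add: powr_add[symmetric] powr_realpow)
      also have "\<dots> \<le> x powr (\<rho> - 1) * (1 + x)" using e by (intro mult_left_mono) auto
      finally have "x ^ p / (1 + x) / c \<le> x powr (\<rho> - 1) / c"
        using x c by (intro divide_right_mono) (auto simp: pos_divide_le_eq)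
      thus ?thesis by (intro mult_right_mono) (auto simp: mult.commute)
    qed
    also have "\<dots> = \<phi>' u"
      using u x False by (simp add: \<phi>'_def x_def powr_mult powr_diff)
    finally show "norm (f' u) \<le> \<phi>' u" .
  qed auto
  thus ?thesis using \<rho>0 by (simp add: f_def \<phi>_def)
qed auto

text \<open>
  Outside a cone around the positive axis, \<open>1 - u b\<close> cannot be small: with \<open>y = u \<bar>b\<bar>\<close> its
  squared norm is at least \<open>1 - 2 \<kappa> y + y\<^sup>2 \<ge> (1 - \<kappa>) (1 + y\<^sup>2)\<close>.
\<close>

lemma norm_one_minus_ray_ge:
  assumes \<kappa>: "0 \<le> \<kappa>" "\<kappa> < 1" and b: "Re b \<le> \<kappa> * norm b" and u: "u \<ge> 0"
  shows "norm (1 - of_real u * b) \<ge> sqrt ((1 - \<kappa>) / 2) * (1 + u * norm b)"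
proof -
  define y where "y = u * norm b"
  have y: "y \<ge> 0" using u by (simp add: y_def)
  have "(1 - \<kappa>) / 2 * (1 + y)\<^sup>2 \<le> (1 - \<kappa>) * (1 + y\<^sup>2)"
  proof -
    have "(1 + y)\<^sup>2 \<le> 2 * (1 + y\<^sup>2)"
      using zero_le_power2[of "1 - y"] by (simp add: power2_eq_square algebra_simps)
    hence "(1 - \<kappa>) / 2 * (1 + y)\<^sup>2 \<le> (1 - \<kappa>) / 2 * (2 * (1 + y\<^sup>2))"
      using \<kappa> by (intro mult_left_mono) auto
    also have "\<dots> = (1 - \<kappa>) * (1 + y\<^sup>2)" by simp
    finally show ?thesis .
  qed
  also have "\<dots> \<le> 1 + y\<^sup>2 - 2 * (\<kappa> * y)"
    using mult_nonneg_nonneg[OF \<kappa>(1) zero_le_power2[of "1 - y"]]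
    by (simp add: power2_eq_square algebra_simps)
  also have "\<dots> \<le> 1 + y\<^sup>2 - 2 * (u * Re b)"
    using mult_left_mono[OF b u] by (simp add: y_def algebra_simps)
  also have "\<dots> = (norm (1 - of_real u * b))\<^sup>2"
    unfolding cmod_power2 y_def power_mult_distrib
    by (simp add: power2_eq_square algebra_simps)
  finally have "sqrt ((1 - \<kappa>) / 2 * (1 + y)\<^sup>2) \<le> norm (1 - of_real u * b)"
    by (intro real_le_lsqrt) auto
  moreover have "sqrt ((1 - \<kappa>) / 2 * (1 + y)\<^sup>2) = sqrt ((1 - \<kappa>) / 2) * (1 + y)"
    unfolding real_sqrt_mult using y by simp
  ultimately show ?thesis by (simp only: y_def)
qed

lemma norm_log_weierstrass_ray_le:
  assumes \<kappa>: "0 \<le> \<kappa>" "\<kappa> < 1" and b: "Re b \<le> \<kappa> * norm b" and t: "t > 0"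
    and \<rho>: "real p < \<rho>" "\<rho> \<le> real p + 1"
  shows "norm (log_weierstrass p (of_real t * b)) \<le> norm b powr \<rho> / (sqrt ((1 - \<kappa>) / 2) * \<rho>) * t powr \<rho>"
proof -
  have "norm (log_weierstrass p (of_real t * b)) \<le>
          norm (of_real t * b) powr \<rho> / (sqrt ((1 - \<kappa>) / 2) * \<rho>)"
  proof (rule norm_log_weierstrass_le)
    fix u :: real assume u: "0 \<le> u" "u \<le> 1"
    show "sqrt ((1 - \<kappa>) / 2) * (1 + u * norm (of_real t * b)) \<le> norm (1 - of_real u * (of_real t * b))"
      using norm_one_minus_ray_ge[OF \<kappa> b, of "u * t"] u t by (simp add: norm_mult mult_ac)
  qed (use \<kappa> \<rho> in auto)
  also have "\<dots> = norm b powr \<rho> / (sqrt ((1 - \<kappa>) / 2) * \<rho>) * t powr \<rho>"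
    using t by (simp add: norm_mult powr_mult)
  finally show ?thesis .
qed

lemma one_minus_notin_nonpos_Reals:
  assumes "(w::complex) \<notin> \<real>\<^sub>\<ge>\<^sub>0"
  shows "1 - w \<notin> \<real>\<^sub>\<le>\<^sub>0"
  using assms by (auto simp: complex_nonpos_Reals_iff complex_nonneg_Reals_iff)

lemma of_real_mult_notin_nonneg_Reals:
  assumes "t > 0" "(b::complex) \<notin> \<real>\<^sub>\<ge>\<^sub>0"
  shows "of_real t * b \<notin> \<real>\<^sub>\<ge>\<^sub>0"
  using assms by (auto simp: complex_nonneg_Reals_iff zero_le_mult_iff)

lemma continuous_on_log_weierstrass_ray:
  assumes "b \<notin> \<real>\<^sub>\<ge>\<^sub>0"
  shows "continuous_on {0<..} (\<lambda>t. log_weierstrass p (of_real t * b))"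
  unfolding log_weierstrass_def
  by (intro continuous_intros one_minus_notin_nonpos_Reals of_real_mult_notin_nonneg_Reals assms) auto

section \<open>Mellin integrals near zero and near infinity\<close>

lemma set_integrable_powr_Ioc:
  assumes "a > -1"
  shows "set_integrable lborel {0<..1} (\<lambda>t::real. t powr a)"
proof -
  have "(\<lambda>t. t powr a) absolutely_integrable_on {0<..1}"
    by (intro nonnegative_absolutely_integrable_1 integrable_on_powr_from_0') (use assms in auto)
  thus ?thesis
    unfolding set_integrable_def by (subst (asm) integrable_completion) auto
qed

lemma set_integrable_powr_Ioi:
  assumes "a < -1"
  shows "set_integrable lborel {1<..} (\<lambda>t::real. t powr a)"
proof -
  have "(\<lambda>t. t powr a) integrable_on {1..}"
    using has_integral_powr_to_inf[of a 1] assms by (auto simp: integrable_on_def)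
  hence "(\<lambda>t. t powr a) absolutely_integrable_on {1..}"
    by (intro nonnegative_absolutely_integrable_1) auto
  hence "set_integrable lborel {1..} (\<lambda>t. t powr a)"
    unfolding set_integrable_def by (subst (asm) integrable_completion) auto
  thus ?thesis by (rule set_integrable_subset) auto
qed

lemma norm_of_real_powr: "t > 0 \<Longrightarrow> norm (of_real t powr s :: complex) = t powr Re s"
  by (subst norm_powr_real_powr) auto

lemma borel_measurable_mellin:
  assumes "continuous_on {0<..} (f :: real \<Rightarrow> complex)" "T \<subseteq> {0<..}" "T \<in> sets borel"
  shows "(\<lambda>t. indicator T t *\<^sub>R (of_real t powr s * f t)) \<in> borel_measurable lborel"
proof -
  have "continuous_on {0<..} (\<lambda>t. of_real t powr s * f t)"
    using assms by (auto intro!: continuous_intros continuous_on_powr_complex)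
  hence "continuous_on T (\<lambda>t. of_real t powr s * f t)"
    using assms(2) continuous_on_subset by blast
  thus ?thesis using borel_measurable_continuous_on_indicator[OF assms(3)] by simp
qed

lemma set_integrable_mellin_0:
  assumes f: "continuous_on {0<..} (f :: real \<Rightarrow> complex)"
    and K: "\<And>t. 0 < t \<Longrightarrow> t \<le> 1 \<Longrightarrow> norm (f t) \<le> K * t powr \<rho>" and s: "Re s < \<rho>"
  shows "set_integrable lborel {0<..1} (\<lambda>t. of_real t powr (-s-1) * f t)"
  unfolding set_integrable_def
proof (rule Bochner_Integration.integrable_bound)
  show "integrable lborel (\<lambda>t. indicator {0<..1} t *\<^sub>R (K * t powr (\<rho> - Re s - 1)))"
    using set_integrable_powr_Ioc[of "\<rho> - Re s - 1"] s
    unfolding set_integrable_def[symmetric] by simp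
  show "(\<lambda>t. indicator {0<..1} t *\<^sub>R (of_real t powr (-s-1) * f t)) \<in> borel_measurable lborel"
    by (rule borel_measurable_mellin[OF f]) auto
  show "AE t in lborel. norm (indicator {0<..1} t *\<^sub>R (of_real t powr (-s-1) * f t)) \<le>
          norm (indicator {0<..1} t *\<^sub>R (K * t powr (\<rho> - Re s - 1)))"
  proof (rule AE_I2)
    fix t :: real
    show "norm (indicator {0<..1} t *\<^sub>R (of_real t powr (-s-1) * f t)) \<le>
          norm (indicator {0<..1} t *\<^sub>R (K * t powr (\<rho> - Re s - 1)))"
    proof (cases "t \<in> {0<..1}")
      case True
      have "norm (of_real t powr (-s-1) * f t) \<le> t powr (-Re s - 1) * (K * t powr \<rho>)"
        using True K by (auto simp: norm_mult norm_of_real_powr intro!: mult_left_mono)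
      also have "\<dots> = K * (t powr (-Re s - 1) * t powr \<rho>)" by simp
      also have "\<dots> = K * t powr (\<rho> - Re s - 1)"
        by (subst powr_add[symmetric]) (simp add: algebra_simps)
      also have "\<dots> \<le> \<bar>K * t powr (\<rho> - Re s - 1)\<bar>" by simp
      finally show ?thesis using True by simp
    qed auto
  qed
qed

lemma set_integrable_mellin_inf:
  assumes f: "continuous_on {0<..} (f :: real \<Rightarrow> complex)"
    and K: "\<And>t. 1 < t \<Longrightarrow> norm (f t) \<le> K * t powr \<rho>" and s: "\<rho> < Re s"
  shows "set_integrable lborel {1<..} (\<lambda>t. of_real t powr (-s-1) * f t)"
  unfolding set_integrable_def
proof (rule Bochner_Integration.integrable_bound)
  show "integrable lborel (\<lambda>t. indicator {1<..} t *\<^sub>R (K * t powr (\<rho> - Re s - 1)))"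
    using set_integrable_powr_Ioi[of "\<rho> - Re s - 1"] s
    unfolding set_integrable_def[symmetric] by simp
  show "(\<lambda>t. indicator {1<..} t *\<^sub>R (of_real t powr (-s-1) * f t)) \<in> borel_measurable lborel"
    by (rule borel_measurable_mellin[OF f]) auto
  show "AE t in lborel. norm (indicator {1<..} t *\<^sub>R (of_real t powr (-s-1) * f t)) \<le>
          norm (indicator {1<..} t *\<^sub>R (K * t powr (\<rho> - Re s - 1)))"
  proof (rule AE_I2)
    fix t :: real
    show "norm (indicator {1<..} t *\<^sub>R (of_real t powr (-s-1) * f t)) \<le>
          norm (indicator {1<..} t *\<^sub>R (K * t powr (\<rho> - Re s - 1)))"
    proof (cases "t \<in> {1<..}")
      case True
      have "norm (of_real t powr (-s-1) * f t) \<le> t powr (-Re s - 1) * (K * t powr \<rho>)"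
        using True K by (auto simp: norm_mult norm_of_real_powr intro!: mult_left_mono)
      also have "\<dots> = K * (t powr (-Re s - 1) * t powr \<rho>)" by simp
      also have "\<dots> = K * t powr (\<rho> - Re s - 1)"
        by (subst powr_add[symmetric]) (simp add: algebra_simps)
      also have "\<dots> \<le> \<bar>K * t powr (\<rho> - Re s - 1)\<bar>" by simp
      finally show ?thesis using True by simp
    qed auto
  qed
qed

text \<open>
  For \<open>t \<le> 1\<close> the weight \<open>t^(-s-1)\<close> grows with \<open>Re s\<close>, so near \<open>s0\<close> the integrand is dominated by
  its value at a real exponent \<open>\<sigma>\<close> between \<open>Re s0\<close> and \<open>\<rho>\<close>. In the lemma after this one, on \<open>t > 1\<close>,
  the order is reversed.
\<close>

lemma holomorphic_mellin_0:
  assumes f: "continuous_on {0<..} (f :: real \<Rightarrow> complex)"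
    and K: "\<And>t. 0 < t \<Longrightarrow> t \<le> 1 \<Longrightarrow> norm (f t) \<le> K * t powr \<rho>"
  shows "(\<lambda>s. LINT t:{0<..1}|lborel. of_real t powr (-s-1) * f t) holomorphic_on {s. Re s < \<rho>}"
  unfolding set_lebesgue_integral_def
proof (rule holomorphic_integral)
  show "open {s. Re s < \<rho>}" by (rule open_halfspace_Re_lt)
  show "(\<lambda>t. indicator {0<..1} t *\<^sub>R (of_real t powr (-s-1) * f t)) \<in> borel_measurable lborel" for s
    by (rule borel_measurable_mellin[OF f]) auto
  show "(\<lambda>s. indicator {0<..1} t *\<^sub>R (of_real t powr (-s-1) * f t)) holomorphic_on {s. Re s < \<rho>}" for t
    by (cases "t \<in> {0<..1}") (auto intro!: holomorphic_intros)
  fix s0 assume s0: "s0 \<in> {s. Re s < \<rho>}"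
  define \<sigma> where "\<sigma> = (Re s0 + \<rho>) / 2"
  have \<sigma>: "Re s0 < \<sigma>" "\<sigma> < \<rho>" using s0 by (auto simp: \<sigma>_def)
  define g where "g t = indicator {0<..1} t *\<^sub>R norm (of_real t powr (- of_real \<sigma> - 1) * f t)" for t :: real
  have "integrable lborel g"
    using integrable_norm[OF set_integrable_mellin_0[OF f K, of "of_real \<sigma>", unfolded set_integrable_def]] \<sigma>
    by (simp add: g_def[abs_def] mult.commute abs_mult)
  moreover have "norm (indicator {0<..1} t *\<^sub>R (of_real t powr (-s-1) * f t)) \<le> g t"
    if "s \<in> ball s0 (\<sigma> - Re s0)" for s t
  proof (cases "t \<in> {0<..1}")
    case True
    have "Re s - Re s0 \<le> norm (s - s0)" using complex_Re_le_cmod[of "s - s0"] by simp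
    hence "Re s < \<sigma>" using that by (simp add: dist_norm norm_minus_commute)
    hence "t powr (-Re s - 1) \<le> t powr (- \<sigma> - 1)" using True by (intro powr_mono') auto
    thus ?thesis using True by (auto simp: g_def norm_mult norm_of_real_powr intro!: mult_right_mono)
  qed (simp add: g_def)
  ultimately show "\<exists>r>0. \<exists>g. integrable lborel g \<and> (\<forall>t\<in>space lborel. \<forall>s\<in>ball s0 r.
      s \<in> {s. Re s < \<rho>} \<longrightarrow> norm (indicator {0<..1} t *\<^sub>R (of_real t powr (-s-1) * f t)) \<le> g t)"
    using \<sigma> by (intro exI[of _ "\<sigma> - Re s0"] exI[of _ g] conjI) auto
qed

lemma holomorphic_mellin_inf:
  assumes f: "continuous_on {0<..} (f :: real \<Rightarrow> complex)"
    and K: "\<And>t. 1 < t \<Longrightarrow> norm (f t) \<le> K * t powr \<rho>"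
  shows "(\<lambda>s. LINT t:{1<..}|lborel. of_real t powr (-s-1) * f t) holomorphic_on {s. \<rho> < Re s}"
  unfolding set_lebesgue_integral_def
proof (rule holomorphic_integral)
  show "open {s. \<rho> < Re s}" by (rule open_halfspace_Re_gt)
  show "(\<lambda>t. indicator {1<..} t *\<^sub>R (of_real t powr (-s-1) * f t)) \<in> borel_measurable lborel" for s
    by (rule borel_measurable_mellin[OF f]) auto
  show "(\<lambda>s. indicator {1<..} t *\<^sub>R (of_real t powr (-s-1) * f t)) holomorphic_on {s. \<rho> < Re s}" for t
    by (cases "t \<in> {1<..}") (auto intro!: holomorphic_intros)
  fix s0 assume s0: "s0 \<in> {s. \<rho> < Re s}"
  define \<sigma> where "\<sigma> = (Re s0 + \<rho>) / 2"
  have \<sigma>: "\<sigma> < Re s0" "\<rho> < \<sigma>" using s0 by (auto simp: \<sigma>_def)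
  define g where "g t = indicator {1<..} t *\<^sub>R norm (of_real t powr (- of_real \<sigma> - 1) * f t)" for t :: real
  have "integrable lborel g"
    using integrable_norm[OF set_integrable_mellin_inf[OF f K, of "of_real \<sigma>", unfolded set_integrable_def]] \<sigma>
    by (simp add: g_def[abs_def] mult.commute abs_mult)
  moreover have "norm (indicator {1<..} t *\<^sub>R (of_real t powr (-s-1) * f t)) \<le> g t"
    if "s \<in> ball s0 (Re s0 - \<sigma>)" for s t
  proof (cases "t \<in> {1<..}")
    case True
    have "Re s0 - Re s \<le> norm (s - s0)" using complex_Re_le_cmod[of "s0 - s"] by (simp add: norm_minus_commute)
    hence "\<sigma> < Re s" using that by (simp add: dist_norm norm_minus_commute)
    hence "t powr (-Re s - 1) \<le> t powr (- \<sigma> - 1)" using True by (intro powr_mono) auto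
    thus ?thesis using True by (auto simp: g_def norm_mult norm_of_real_powr intro!: mult_right_mono)
  qed (simp add: g_def)
  ultimately show "\<exists>r>0. \<exists>g. integrable lborel g \<and> (\<forall>t\<in>space lborel. \<forall>s\<in>ball s0 r.
      s \<in> {s. \<rho> < Re s} \<longrightarrow> norm (indicator {1<..} t *\<^sub>R (of_real t powr (-s-1) * f t)) \<le> g t)"
    using \<sigma> by (intro exI[of _ "Re s0 - \<sigma>"] exI[of _ g] conjI) auto
qed

lemma set_integrable_mellin:
  assumes f: "continuous_on {0<..} (f :: real \<Rightarrow> complex)"
    and "\<And>t. 0 < t \<Longrightarrow> t \<le> 1 \<Longrightarrow> norm (f t) \<le> K * t powr \<rho>" "Re s < \<rho>"
    and "\<And>t. 1 < t \<Longrightarrow> norm (f t) \<le> K' * t powr \<rho>'" "\<rho>' < Re s"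
  shows "set_integrable lborel {0<..} (\<lambda>t. of_real t powr (-s-1) * f t)"
proof -
  have "set_integrable lborel ({0<..1} \<union> {1<..}) (\<lambda>t. of_real t powr (-s-1) * f t)"
    by (intro set_integrable_Un set_integrable_mellin_0[of f K \<rho>] set_integrable_mellin_inf[of f K' \<rho>'] assms) auto
  also have "{0<..1} \<union> {1<..} = {0::real<..}" by auto
  finally show ?thesis .
qed

section \<open>The Mellin transform of a single logarithmic factor\<close>

text \<open>
  The substitution \<open>t = x / (1 - x)\<close> turns this into the Beta integral at \<open>(y, 1 - y)\<close>, which
  the reflection formula of the Gamma function evaluates.
\<close>

lemma Stieltjes_integral:
  fixes y :: real
  assumes "0 < y" "y < 1"
  shows "set_integrable lborel {0<..} (\<lambda>t. t powr (y - 1) / (1 + t))"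
    and "(LINT t:{0<..}|lborel. t powr (y - 1) / (1 + t)) = pi / sin (pi * y)"
proof -
  define f where "f t = t powr (y - 1) / (1 + t)" for t :: real
  define g where "g x = x / (1 - x)" for x :: real
  define g' where "g' x = 1 / (1 - x)^2" for x :: real
  have eq: "f (g x) * g' x = x powr (y - 1) * (1 - x) powr (1 - y - 1)" if "0 < x" "x < 1" for x
  proof -
    have 1: "1 + g x = 1 / (1 - x)" using that by (simp add: g_def field_simps)
    have "f (g x) * g' x = x powr (y - 1) / (1 - x) powr (y - 1) * (1 - x) / (1 - x)^2"
      using that unfolding f_def 1 by (simp add: g_def g'_def powr_divide)
    also have "\<dots> = x powr (y - 1) / ((1 - x) powr (y - 1) * (1 - x) powr 1)"
      using that by (simp add: power2_eq_square)
    also have "(1 - x) powr (y - 1) * (1 - x) powr 1 = (1 - x) powr y"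
      by (subst powr_add[symmetric]) simp
    also have "x powr (y - 1) / (1 - x) powr y = x powr (y - 1) * (1 - x) powr (1 - y - 1)"
      using powr_minus_divide[of "1 - x" y] by simp
    finally show ?thesis .
  qed
  have ei: "einterval 0 1 = {0<..<1::real}" "einterval 0 \<infinity> = {0<..}"
    by (auto simp: einterval_def zero_ereal_def one_ereal_def)
  have B: "set_integrable lborel {0<..<1} (\<lambda>x. x powr (y - 1) * (1 - x) powr (1 - y - 1))"
    by (rule set_integrable_subset[OF integrable_Beta[of y "1 - y"]]) (use assms in auto)
  \<comment> \<open>the substitution rule states its conditions in terms of extended reals\<close>
  have S: "0 < ereal x \<Longrightarrow> ereal x < 1 \<Longrightarrow> 0 < x \<and> x < 1" for x
    by (auto simp: one_ereal_def)
  have dg: "DERIV g x :> g' x" if "0 < ereal x" "ereal x < 1" for x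
    unfolding g_def g'_def
    using S[OF that] by (auto intro!: derivative_eq_intros simp: field_simps power2_eq_square)
  have cf: "isCont f (g x)" if "0 < ereal x" "ereal x < 1" for x
  proof -
    have "g x > 0" using S[OF that] by (simp add: g_def)
    thus ?thesis unfolding f_def by (auto intro!: continuous_intros)
  qed
  have cg': "isCont g' x" if "0 < ereal x" "ereal x < 1" for x
    unfolding g'_def using S[OF that] by (auto intro!: continuous_intros)
  have fn: "0 \<le> f (g x)" if "0 < ereal x" "ereal x < 1" for x
    using S[OF that] by (auto simp: f_def g_def)
  have gn: "0 \<le> g' x" if "0 \<le> ereal x" "ereal x \<le> 1" for x
    by (auto simp: g'_def)
  have l0: "((ereal \<circ> g \<circ> real_of_ereal) \<longlongrightarrow> 0) (at_right 0)"
    unfolding zero_ereal_def ereal_tendsto_simps g_def by (auto intro!: tendsto_eq_intros)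
  have "LIM x at_left (1::real). x / (1 - x) :> at_top"
    by real_asymp
  hence l1: "((ereal \<circ> g \<circ> real_of_ereal) \<longlongrightarrow> \<infinity>) (at_left 1)"
    unfolding one_ereal_def ereal_tendsto_simps g_def .
  have i: "set_integrable lborel (einterval 0 1) (\<lambda>x. f (g x) * g' x)"
    unfolding ei using B by (subst set_integrable_cong[OF refl refl eq]) auto
  note sub = interval_integral_substitution_nonneg[OF _ dg cf cg' fn gn l0 l1 i]
  have I: "set_integrable lborel {0<..} f"
    and L: "(LBINT x=0..\<infinity>. f x) = (LBINT x=0..1. f (g x) * g' x)"
    using sub by (auto simp: ei)
  from I show "set_integrable lborel {0<..} (\<lambda>t. t powr (y - 1) / (1 + t))"
    unfolding f_def .
  have "(LINT t:{0<..}|lborel. f t) = (LBINT x=0..\<infinity>. f x)"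
    by (simp add: interval_lebesgue_integral_def ei)
  also have "\<dots> = (LINT x:{0<..<1}|lborel. f (g x) * g' x)"
    unfolding L by (simp add: interval_lebesgue_integral_def ei)
  also have "\<dots> = (LINT x:{0<..<1}|lborel. x powr (y - 1) * (1 - x) powr (1 - y - 1))"
    by (intro set_lebesgue_integral_cong) (use eq in auto)
  also have "\<dots> = integral {0<..<1} (\<lambda>x. x powr (y - 1) * (1 - x) powr (1 - y - 1))"
    using set_borel_integral_eq_integral(2)[OF B] .
  also have "\<dots> = Beta y (1 - y)"
    using has_integral_Beta_real[of y "1 - y"] assms
    by (intro integral_unique) (simp add: has_integral_Icc_iff_Ioo)
  also have "\<dots> = pi / sin (pi * y)"
  proof -
    have "complex_of_real (Gamma y * Gamma (1 - y)) = Gamma (of_real y) * Gamma (1 - of_real y)"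
      using Gamma_complex_of_real[of y] Gamma_complex_of_real[of "1 - y"] by simp
    also have "\<dots> = of_real pi / sin (of_real pi * of_real y)"
      by (rule Gamma_reflection_complex)
    also have "\<dots> = of_real (pi / sin (pi * y))"
      by (metis of_real_divide of_real_mult sin_of_real)
    finally have "complex_of_real (Gamma y * Gamma (1 - y)) = of_real (pi / sin (pi * y))" .
    hence "Gamma y * Gamma (1 - y) = pi / sin (pi * y)" by (simp only: of_real_eq_iff)
    thus ?thesis by (simp add: Beta_def)
  qed
  finally show "(LINT t:{0<..}|lborel. t powr (y - 1) / (1 + t)) = pi / sin (pi * y)"
    by (simp add: f_def)
qed

lemma norm_log_weierstrass_neg_le:
  assumes "t > 0" "real p < \<rho>" "\<rho> \<le> real p + 1"
  shows "norm (log_weierstrass p (- of_real t)) \<le> t powr \<rho> / \<rho>"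
proof -
  have "norm (log_weierstrass p (- of_real t)) \<le> norm (- of_real t :: complex) powr \<rho> / (1 * \<rho>)"
  proof (rule norm_log_weierstrass_le)
    fix u :: real assume u: "0 \<le> u" "u \<le> 1"
    have "1 - of_real u * (- of_real t) = (of_real (1 + u * t) :: complex)" by simp
    also have "norm \<dots> = 1 + u * t" unfolding norm_of_real using u assms by simp
    finally show "1 * (1 + u * norm (- of_real t :: complex)) \<le> norm (1 - of_real u * (- of_real t) :: complex)"
      using assms by simp
  qed (use assms in auto)
  thus ?thesis using assms by simp
qed

lemma tendsto_powr_at_right_0: "a > 0 \<Longrightarrow> ((\<lambda>t::real. t powr a) \<longlongrightarrow> 0) (at_right 0)"
  by real_asymp

text \<open>
  Integration by parts: the derivative of \<open>log_weierstrass p (- t)\<close> is \<open>(-t)^p / (1 + t)\<close>, so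
  the transform is \<open>(-1)^p / r\<close> times the integral of \<open>Stieltjes_integral\<close> at \<open>y = p + 1 - r\<close>. The growth
  bounds with exponents \<open>p + 1 > r\<close> at \<open>0\<close> and \<open>\<rho> < r\<close> at infinity kill the boundary terms. The sign
  \<open>(-1)^p\<close> disappears against \<open>sin (\<pi> y) = (-1)^p sin (\<pi> r)\<close>, which is why the result has the same
  form for every genus.
\<close>

lemma mellin_log_weierstrass_neg:
  fixes r :: real
  assumes r: "real p < r" "r < real p + 1"
  shows "(LINT t:{0<..}|lborel. of_real t powr (- of_real r - 1) * log_weierstrass p (- of_real t))
           = of_real (pi / (r * sin (pi * r)))"
proof -
  define f where "f t = log_weierstrass p (- of_real t)" for t :: real
  define y where "y = real p + 1 - r"
  define \<rho> where "\<rho> = (real p + r) / 2"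
  have \<rho>: "real p < \<rho>" "\<rho> < r" "\<rho> \<le> real p + 1" "\<rho> > 0" "r > 0" using r by (auto simp: \<rho>_def)
  have y: "0 < y" "y < 1" using r by (auto simp: y_def)
  have df: "(f has_vector_derivative (- of_real t) ^ p / (1 + of_real t)) (at t)" if "t > 0" for t
  proof -
    have "((\<lambda>t. - of_real t :: complex) has_vector_derivative -1) (at t)"
      by (auto intro!: derivative_eq_intros)
    moreover have "1 - (- complex_of_real t) \<notin> \<real>\<^sub>\<le>\<^sub>0"
      using that by (auto simp: complex_nonpos_Reals_iff)
    ultimately show ?thesis
      using field_vector_diff_chain_at[OF _ has_field_derivative_log_weierstrass, of "\<lambda>t. - of_real t" "-1" t p]
      unfolding f_def[abs_def] o_def by simp
  qed
  have cf: "continuous_on {0<..} f"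
    by (intro continuous_at_imp_continuous_on ballI has_vector_derivative_continuous[OF df]) auto
  have b1: "norm (f t) \<le> 1 / (real p + 1) * t powr (real p + 1)" if "t > 0" for t
    using norm_log_weierstrass_neg_le[of t p "real p + 1"] that by (simp add: f_def)
  have b2: "norm (f t) \<le> 1 / \<rho> * t powr \<rho>" if "t > 0" for t
    using norm_log_weierstrass_neg_le[of t p \<rho>] \<rho> that by (simp add: f_def)
  have I1: "set_integrable lborel {0<..} (\<lambda>t. of_real t powr (- of_real r - 1) * f t)"
    by (rule set_integrable_mellin[OF cf b1 _ b2]) (use r \<rho> in auto)
  define h where "h t = t powr (y - 1) / (1 + t)" for t :: real
  have I2: "set_integrable lborel {0<..} (\<lambda>t. (-1) ^ p / of_real r * of_real (h t) :: complex)"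
  proof -
    have "integrable lborel (\<lambda>x. (-1) ^ p / of_real r * complex_of_real (indicat_real {0<..} x *\<^sub>R h x))"
      using Stieltjes_integral(1)[OF y] unfolding set_integrable_def h_def
      by (intro integrable_mult_right integrable_of_real) auto
    thus ?thesis unfolding set_integrable_def by (simp add: mult_ac scaleR_conv_of_real)
  qed
  \<comment> \<open>the antiderivative that encodes the integration by parts\<close>
  define F where "F t = - of_real (t powr (-r) / r) * f t" for t
  define F' where "F' t = of_real t powr (- of_real r - 1) * f t - (-1) ^ p / of_real r * of_real (h t)" for t
  have ei: "einterval 0 \<infinity> = {0::real<..}" by (auto simp: einterval_def zero_ereal_def)
  have dF: "(F has_vector_derivative F' t) (at t)" if "0 < ereal t" for t
  proof -
    have t: "t > 0" using that by simp
    have "((\<lambda>t. t powr (-r) / r) has_real_derivative - (t powr (-r-1))) (at t)"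
      using t \<rho> by (auto intro!: derivative_eq_intros)
    hence "((\<lambda>t. complex_of_real (t powr (-r) / r)) has_vector_derivative of_real (- (t powr (-r-1)))) (at t)"
      by (intro has_vector_derivative_of_real) (simp add: has_real_derivative_iff_has_vector_derivative)
    hence "((\<lambda>t. - complex_of_real (t powr (-r) / r)) has_vector_derivative of_real (t powr (-r-1))) (at t)"
      using has_vector_derivative_minus by fastforce
    from has_vector_derivative_mult[OF this df[OF t]]
    have "(F has_vector_derivative - (of_real (t powr (-r) / r) * ((- of_real t) ^ p / (1 + of_real t))) +
            of_real (t powr (-r-1)) * f t) (at t)"
      by (simp add: F_def[abs_def])
    also have "of_real (t powr (-r) / r) * ((- of_real t) ^ p / (1 + of_real t)) =
                 (-1) ^ p / of_real r * complex_of_real (h t)"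
    proof -
      have "t powr (y - 1) = t ^ p * t powr (-r)"
        using t by (simp add: y_def powr_realpow[symmetric] powr_add[symmetric])
      thus ?thesis using t by (simp add: h_def power_minus[of "of_real t"] mult_ac)
    qed
    also have "complex_of_real (t powr (-r-1)) = of_real t powr (- of_real r - 1)"
      using powr_of_real[of t "-r-1"] t by simp
    finally show ?thesis by (simp add: F'_def algebra_simps)
  qed
  have cF': "isCont F' t" if "0 < ereal t" for t
  proof -
    have t: "t > 0" using that by simp
    have "continuous_on {0<..} F'"
      unfolding F'_def h_def by (intro continuous_intros cf continuous_on_powr_complex) auto
    thus ?thesis using t by (simp add: continuous_on_eq_continuous_at)
  qed
  have iF': "set_integrable lborel (einterval 0 \<infinity>) F'"
    unfolding ei F'_def using set_integral_diff(1)[OF I1 I2] .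
  have nF: "norm (F t) = t powr (-r) / r * norm (f t)" if "t > 0" for t
    using that \<rho> by (simp add: F_def norm_mult norm_divide)
  have "(F \<longlongrightarrow> 0) (at_right 0)"
  proof (rule Lim_null_comparison)
    show "\<forall>\<^sub>F t in at_right 0. norm (F t) \<le> 1 / (r * (real p + 1)) * t powr (real p + 1 - r)"
    proof (rule eventually_at_right_less[THEN eventually_mono])
      fix t :: real assume t: "0 < t"
      have "norm (F t) \<le> t powr (-r) / r * (1 / (real p + 1) * t powr (real p + 1))"
        unfolding nF[OF t] using b1[OF t] \<rho> by (intro mult_left_mono) auto
      also have "\<dots> = 1 / (r * (real p + 1)) * (t powr (-r) * t powr (real p + 1))" by simp
      finally show "norm (F t) \<le> 1 / (r * (real p + 1)) * t powr (real p + 1 - r)"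
        unfolding powr_add[symmetric] by (simp add: algebra_simps)
    qed
    show "((\<lambda>t. 1 / (r * (real p + 1)) * t powr (real p + 1 - r)) \<longlongrightarrow> 0) (at_right 0)"
      using r by (intro tendsto_mult_right_zero tendsto_powr_at_right_0) auto
  qed
  hence l0: "((F \<circ> real_of_ereal) \<longlongrightarrow> 0) (at_right 0)"
    unfolding zero_ereal_def ereal_tendsto_simps .
  have "(F \<longlongrightarrow> 0) at_top"
  proof (rule Lim_null_comparison)
    show "\<forall>\<^sub>F t in at_top. norm (F t) \<le> 1 / (r * \<rho>) * t powr (-(r - \<rho>))"
    proof (rule eventually_gt_at_top[of 0, THEN eventually_mono])
      fix t :: real assume t: "0 < t"
      have "norm (F t) \<le> t powr (-r) / r * (1 / \<rho> * t powr \<rho>)"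
        unfolding nF[OF t] using b2[OF t] \<rho> by (intro mult_left_mono) auto
      also have "\<dots> = 1 / (r * \<rho>) * (t powr (-r) * t powr \<rho>)" by simp
      finally show "norm (F t) \<le> 1 / (r * \<rho>) * t powr (-(r - \<rho>))"
        unfolding powr_add[symmetric] by (simp add: algebra_simps)
    qed
    show "((\<lambda>t. 1 / (r * \<rho>) * t powr (-(r - \<rho>))) \<longlongrightarrow> 0) at_top"
      using \<rho> by (intro tendsto_mult_right_zero tendsto_neg_powr filterlim_ident) auto
  qed
  hence l1: "((F \<circ> real_of_ereal) \<longlongrightarrow> 0) (at_left \<infinity>)"
    unfolding ereal_tendsto_simps .
  have "(LBINT t=0..\<infinity>. F' t) = 0 - 0"
    by (rule interval_integral_FTC_integrable[OF _ dF cF' iF' l0 l1]) auto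
  hence "(LINT t:{0<..}|lborel. F' t) = 0"
    by (simp add: interval_lebesgue_integral_def ei)
  hence "(LINT t:{0<..}|lborel. of_real t powr (- of_real r - 1) * f t) =
         (LINT t:{0<..}|lborel. (-1) ^ p / of_real r * complex_of_real (h t))"
    unfolding F'_def using set_integral_diff(2)[OF I1 I2] by simp
  also have "\<dots> = (-1) ^ p / of_real r * (LINT t:{0<..}|lborel. complex_of_real (h t))"
    by simp
  also have "(LINT t:{0<..}|lborel. complex_of_real (h t)) = of_real (LINT t:{0<..}|lborel. h t)"
    by (rule set_integral_complex_of_real)
  also have "(LINT t:{0<..}|lborel. h t) = pi / sin (pi * y)"
    unfolding h_def by (rule Stieltjes_integral(2)[OF y])
  also have "sin (pi * y) = (-1) ^ p * sin (pi * r)"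
  proof -
    have "pi * y = real p * pi + (pi - pi * r)" by (simp add: y_def algebra_simps)
    hence "sin (pi * y) = cos (real p * pi) * sin (pi - pi * r) + sin (real p * pi) * cos (pi - pi * r)"
      by (simp only: sin_add mult.commute add.commute)
    thus ?thesis by (simp add: sin_npi cos_npi)
  qed
  also have "(-1) ^ p / of_real r * complex_of_real (pi / ((-1) ^ p * sin (pi * r))) =
               of_real (pi / (r * sin (pi * r)))"
    by (cases "even p") simp_all
  finally show ?thesis unfolding f_def .
qed

lemma mellin_log_weierstrass_pos_scaled:
  fixes r x :: real
  assumes r: "real p < r" "r < real p + 1" and x: "x > 0"
  shows "(LINT t:{0<..}|lborel. of_real t powr (- of_real r - 1) * log_weierstrass p (- (of_real t * of_real x)))
           = of_real (pi / (r * sin (pi * r))) * of_real x powr of_real r"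
proof -
  define g where "g t = indicator {0<..} t *\<^sub>R (of_real t powr (- of_real r - 1) * log_weierstrass p (- of_real t))" for t :: real
  have eq: "g (0 + x * t) = (of_real x powr (- of_real r - 1)) * (indicator {0<..} t *\<^sub>R (of_real t powr (- of_real r - 1) * log_weierstrass p (- (of_real t * of_real x))))" for t
  proof (cases "t > 0")
    case True
    have "of_real (x * t) powr (- of_real r - 1 :: complex) = of_real x powr (- of_real r - 1) * of_real t powr (- of_real r - 1)"
      unfolding of_real_mult using x True by (intro powr_times_real) auto
    thus ?thesis using True x by (simp add: g_def mult_ac)
  qed (use x in \<open>auto simp: g_def zero_less_mult_iff\<close>)
  have "integral\<^sup>L lborel g = \<bar>x\<bar> *\<^sub>R (\<integral>t. g (0 + x * t) \<partial>lborel)"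
    using x by (intro lborel_integral_real_affine) auto
  also have "\<dots> = of_real x * of_real x powr (- of_real r - 1) *
      (LINT t:{0<..}|lborel. of_real t powr (- of_real r - 1) * log_weierstrass p (- (of_real t * of_real x)))"
    unfolding eq set_lebesgue_integral_def integral_mult_right_zero using x
    by (simp add: scaleR_conv_of_real[of x] mult.assoc)
  also have "of_real x * of_real x powr (- of_real r - 1) = inverse (of_real x powr of_real r :: complex)"
    using x by (simp add: powr_diff powr_minus)
  also have "integral\<^sup>L lborel g = of_real (pi / (r * sin (pi * r)))"
    using mellin_log_weierstrass_neg[OF r] unfolding g_def[abs_def] set_lebesgue_integral_def .
  finally show ?thesis using x by (simp add: field_simps)
qed

text \<open>
  Both sides are holomorphic in \<open>w\<close> on the plane slit along the negative axis, and they agree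
  for positive \<open>w\<close> by scaling.
\<close>

lemma mellin_log_weierstrass:
  fixes r :: real and w :: complex
  assumes r: "real p < r" "r < real p + 1" and w: "w \<notin> \<real>\<^sub>\<le>\<^sub>0"
  shows "(LINT t:{0<..}|lborel. of_real t powr (- of_real r - 1) * log_weierstrass p (of_real t * (- w)))
           = of_real (pi / (r * sin (pi * r))) * w powr of_real r"
proof (rule holomorphic_eq_if_eq_on_real_interval[where S = "- \<real>\<^sub>\<le>\<^sub>0" and a = 0 and b = 1 and z = w
    and f = "\<lambda>w. LINT t:{0<..}|lborel. of_real t powr (- of_real r - 1) * log_weierstrass p (of_real t * (- w))"
    and g = "\<lambda>w. of_real (pi / (r * sin (pi * r))) * w powr of_real r"])
  let ?U = "- \<real>\<^sub>\<le>\<^sub>0 :: complex set"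
  show U: "open ?U" by (simp add: open_Compl)
  have "?U = - (complex_of_real ` {..0})"
    by (auto simp: nonpos_Reals_def)
  thus "connected ?U"
    using starlike_slotted_complex_plane_left[of 0] starlike_imp_connected by auto
  show "(\<lambda>w. of_real (pi / (r * sin (pi * r))) * w powr of_real r) holomorphic_on ?U"
    by (auto intro!: holomorphic_intros)
  define \<rho> where "\<rho> = (real p + r) / 2"
  have \<rho>: "real p < \<rho>" "\<rho> < r" "\<rho> \<le> real p + 1" "\<rho> > 0" "r > 0" using r by (auto simp: \<rho>_def)
  show "(\<lambda>w. LINT t:{0<..}|lborel. of_real t powr (- of_real r - 1) * log_weierstrass p (of_real t * (- w)))
          holomorphic_on ?U"
    unfolding set_lebesgue_integral_def
  proof (rule holomorphic_integral[OF U])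
    fix w assume "w \<in> ?U"
    hence w: "- w \<notin> \<real>\<^sub>\<ge>\<^sub>0" by (auto simp: complex_nonpos_Reals_iff complex_nonneg_Reals_iff)
    show "(\<lambda>t. indicator {0<..} t *\<^sub>R (of_real t powr (- of_real r - 1) * log_weierstrass p (of_real t * (- w))))
            \<in> borel_measurable lborel"
      by (rule borel_measurable_mellin[OF continuous_on_log_weierstrass_ray[OF w]]) auto
  next
    fix t :: real
    show "(\<lambda>w. indicator {0<..} t *\<^sub>R (of_real t powr (- of_real r - 1) * log_weierstrass p (of_real t * (- w))))
            holomorphic_on ?U"
    proof (cases "t > 0")
      case True
      have "1 - of_real t * (- w) \<notin> \<real>\<^sub>\<le>\<^sub>0" if "w \<in> ?U" for w
        using that True
        by (intro one_minus_notin_nonpos_Reals of_real_mult_notin_nonneg_Reals)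
           (auto simp: complex_nonpos_Reals_iff complex_nonneg_Reals_iff)
      thus ?thesis
        unfolding log_weierstrass_def by (intro holomorphic_intros) auto
    qed auto
  next
    fix w0 assume w0: "w0 \<in> ?U"
    hence w0': "w0 \<noteq> 0" by auto
    have lt: "- Re w0 < norm w0"
    proof (rule ccontr)
      assume "\<not> - Re w0 < norm w0"
      hence 1: "norm w0 = - Re w0" using abs_Re_le_cmod[of w0] by linarith
      hence "Im w0 = 0" using cmod_power2[of w0] by simp
      moreover have "Re w0 \<le> 0" using 1 norm_ge_zero[of w0] by linarith
      ultimately show False using w0 by (auto simp: complex_nonpos_Reals_iff)
    qed
    \<comment> \<open>a cone constant strictly between the direction of \<open>w0\<close> and \<open>1\<close>, so that it serves all nearby directions\<close>
    define \<kappa> where "\<kappa> = (1 + max 0 (- Re w0 / norm w0)) / 2"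
    have mx: "0 \<le> max 0 (- Re w0 / norm w0)" "max 0 (- Re w0 / norm w0) < 1"
      using lt w0' by (auto simp: max_def field_simps)
    have \<kappa>: "0 \<le> \<kappa>" "\<kappa> < 1" and "max 0 (- Re w0 / norm w0) < \<kappa>"
      using mx by (auto simp: \<kappa>_def field_simps)
    hence "- Re w0 / norm w0 < \<kappa>" by simp
    hence cone: "- Re w0 < \<kappa> * norm w0" using w0' pos_divide_less_eq[of "norm w0" "- Re w0" \<kappa>] by auto
    define V where "V = {w. - Re w < \<kappa> * norm w} \<inter> {w. norm w < norm w0 + 1}"
    have "open V" unfolding V_def
      by (intro open_Int open_Collect_less continuous_intros)
    moreover have "w0 \<in> V" using cone by (simp add: V_def)
    ultimately obtain d where d: "d > 0" "ball w0 d \<subseteq> V" using open_contains_ball by blast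
    define C where "C \<rho> = (norm w0 + 1) powr \<rho> / (sqrt ((1 - \<kappa>) / 2) * \<rho>)" for \<rho>
    have bound: "norm (log_weierstrass p (of_real t * (- w))) \<le> C \<rho> * t powr \<rho>"
      if "w \<in> V" "t > 0" "real p < \<rho>" "\<rho> \<le> real p + 1" for w t \<rho>
    proof -
      have "norm (log_weierstrass p (of_real t * (- w))) \<le> norm (- w) powr \<rho> / (sqrt ((1 - \<kappa>) / 2) * \<rho>) * t powr \<rho>"
        by (rule norm_log_weierstrass_ray_le[OF \<kappa>]) (use that in \<open>auto simp: V_def\<close>)
      also have "\<dots> \<le> C \<rho> * t powr \<rho>"
        unfolding C_def using that \<kappa>
        by (intro mult_right_mono divide_right_mono powr_mono2) (auto simp: V_def)
      finally show ?thesis .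
    qed
    define g where "g t = indicator {0<..1} t *\<^sub>R (C (real p + 1) * t powr (real p - r)) +
        indicator {1<..} t *\<^sub>R (C \<rho> * t powr (\<rho> - r - 1))" for t :: real
    have "integrable lborel g" unfolding g_def
    proof (rule Bochner_Integration.integrable_add)
      show "integrable lborel (\<lambda>t. indicator {0<..1} t *\<^sub>R (C (real p + 1) * t powr (real p - r)))"
        using set_integrable_powr_Ioc[of "real p - r"] r
        unfolding set_integrable_def[symmetric] by simp
      show "integrable lborel (\<lambda>t. indicator {1<..} t *\<^sub>R (C \<rho> * t powr (\<rho> - r - 1)))"
        using set_integrable_powr_Ioi[of "\<rho> - r - 1"] \<rho>
        unfolding set_integrable_def[symmetric] by simp
    qed
    moreover have "norm (indicator {0<..} t *\<^sub>R (of_real t powr (- of_real r - 1) * log_weierstrass p (of_real t * (- w)))) \<le> g t"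
      if "w \<in> V" for t w
    proof (cases "t > 0")
      case True
      have n: "norm (of_real t powr (- of_real r - 1) :: complex) = t powr (- r - 1)"
        using True by (simp add: norm_of_real_powr)
      have *: "norm (of_real t powr (- of_real r - 1) * log_weierstrass p (of_real t * (- w))) \<le> C \<rho> * t powr (\<rho> - r - 1)"
        if "real p < \<rho>" "\<rho> \<le> real p + 1" for \<rho>
      proof -
        have "norm (of_real t powr (- of_real r - 1) * log_weierstrass p (of_real t * (- w))) \<le> t powr (- r - 1) * (C \<rho> * t powr \<rho>)"
          unfolding norm_mult n by (intro mult_left_mono bound \<open>w \<in> V\<close> True that) auto
        also have "\<dots> = C \<rho> * (t powr (-r - 1) * t powr \<rho>)" by simp
        also have "\<dots> = C \<rho> * t powr (\<rho> - r - 1)"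
          by (subst powr_add[symmetric]) (simp add: algebra_simps)
        finally show ?thesis .
      qed
      show ?thesis
      proof (cases "t \<le> 1")
        case True
        thus ?thesis using *[of "real p + 1"] \<open>t > 0\<close> by (simp add: g_def)
      next
        case False
        thus ?thesis using *[of \<rho>] \<rho> \<open>t > 0\<close> by (simp add: g_def)
      qed
    qed (simp add: g_def)
    ultimately show "\<exists>d>0. \<exists>g. integrable lborel g \<and> (\<forall>t\<in>space lborel. \<forall>w\<in>ball w0 d. w \<in> ?U \<longrightarrow>
       norm (indicator {0<..} t *\<^sub>R (of_real t powr (- of_real r - 1) * log_weierstrass p (of_real t * (- w)))) \<le> g t)"
      using d by (intro exI[of _ d] exI[of _ g] conjI) blast+
  qed
  fix x :: real assume x: "0 < x" "x < 1"
  show "of_real x \<in> ?U" using x by (auto simp: complex_nonpos_Reals_iff)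
  show "(LINT t:{0<..}|lborel. of_real t powr (- of_real r - 1) * log_weierstrass p (of_real t * (- of_real x)))
           = of_real (pi / (r * sin (pi * r))) * of_real x powr of_real r"
    using mellin_log_weierstrass_pos_scaled[OF r x(1)] by simp
qed (use w in auto)

section \<open>Continuation of Mellin transforms past a power-logarithm expansion\<close>

lemma integral_powr_Ioi:
  fixes c :: real
  assumes "c > 0"
  shows "set_integrable lborel {1<..} (\<lambda>t::real. t powr (- c - 1))"
    and "(LINT t:{1<..}|lborel. t powr (- c - 1)) = 1 / c"
    and "set_integrable lborel {1<..} (\<lambda>t::real. t powr (- c - 1) * ln t)"
    and "(LINT t:{1<..}|lborel. t powr (- c - 1) * ln t) = 1 / c\<^sup>2"
proof -
  have ei: "einterval 1 \<infinity> = {1::real<..}" by (auto simp: einterval_def one_ereal_def)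
  have t1: "1 < ereal t \<longleftrightarrow> 1 < t" for t by (simp add: one_ereal_def)
  define F where "F t = - (t powr (- c) / c)" for t
  define G where "G t = - (t powr (- c) * (ln t / c + 1 / c\<^sup>2))" for t
  have dF: "DERIV F t :> t powr (- c - 1)" if "1 < ereal t" for t
  proof -
    have "c \<noteq> 0" "t > 0" using that assms by (auto simp: t1)
    have "((\<lambda>t. t powr (- c)) has_real_derivative - c * t powr (- c - 1)) (at t)"
      using \<open>t > 0\<close> by (rule has_real_derivative_powr)
    from DERIV_minus[OF DERIV_cdivide[OF this, of c]] show ?thesis
      using \<open>c \<noteq> 0\<close> by (simp add: F_def[abs_def])
  qed
  have dG: "DERIV G t :> t powr (- c - 1) * ln t" if "1 < ereal t" for t
  proof -
    have "t > 0" using that by (simp add: t1)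
    moreover have "t powr (- c) = t powr (- c - 1) * t"
      using \<open>t > 0\<close> by (simp add: powr_diff)
    ultimately show ?thesis
      using assms unfolding G_def
      by (auto intro!: derivative_eq_intros simp: field_simps power2_eq_square)
  qed
  have F1: "((F \<circ> real_of_ereal) \<longlongrightarrow> F 1) (at_right 1)"
    unfolding one_ereal_def ereal_tendsto_simps F_def using assms by (intro tendsto_intros) auto
  have G1: "((G \<circ> real_of_ereal) \<longlongrightarrow> G 1) (at_right 1)"
    unfolding one_ereal_def ereal_tendsto_simps G_def using assms by (intro tendsto_intros) auto
  have "(F \<longlongrightarrow> 0) at_top" unfolding F_def using assms by real_asymp
  hence F2: "((F \<circ> real_of_ereal) \<longlongrightarrow> 0) (at_left \<infinity>)" unfolding ereal_tendsto_simps .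
  have "(G \<longlongrightarrow> 0) at_top" unfolding G_def using assms by real_asymp
  hence G2: "((G \<circ> real_of_ereal) \<longlongrightarrow> 0) (at_left \<infinity>)" unfolding ereal_tendsto_simps .
  have cF: "isCont (\<lambda>t. t powr (- c - 1)) t" if "1 < ereal t" for t
    using that unfolding t1 by (auto intro!: continuous_intros)
  have cG: "isCont (\<lambda>t. t powr (- c - 1) * ln t) t" if "1 < ereal t" for t
    using that unfolding t1 by (auto intro!: continuous_intros)
  have nF: "AE t in lborel. 1 < ereal t \<longrightarrow> ereal t < \<infinity> \<longrightarrow> 0 \<le> t powr (- c - 1)" by simp
  have nG: "AE t in lborel. 1 < ereal t \<longrightarrow> ereal t < \<infinity> \<longrightarrow> 0 \<le> t powr (- c - 1) * ln t"
    by (simp add: t1)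
  note iF = interval_integral_FTC_nonneg[OF _ dF cF nF F1 F2]
  note iG = interval_integral_FTC_nonneg[OF _ dG cG nG G1 G2]
  show "set_integrable lborel {1<..} (\<lambda>t::real. t powr (- c - 1))"
    using iF(1) by (simp add: ei)
  show "(LINT t:{1<..}|lborel. t powr (- c - 1)) = 1 / c"
    using iF(2) by (simp add: interval_lebesgue_integral_def ei F_def)
  show "set_integrable lborel {1<..} (\<lambda>t::real. t powr (- c - 1) * ln t)"
    using iG(1) by (simp add: ei)
  show "(LINT t:{1<..}|lborel. t powr (- c - 1) * ln t) = 1 / c\<^sup>2"
    using iG(2) by (simp add: interval_lebesgue_integral_def ei G_def)
qed

text \<open>
  The Mellin transform of \<open>h\<close>, with the part over \<open>t > 1\<close> rewritten for a function of the form
  \<open>h = R + \<Sum>\<^sub>j t^(\<beta> j) (A j + B j ln t)\<close>: only the remainder \<open>R\<close> is still integrated, so the formula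
  makes sense to the left of the exponents \<open>\<beta> j\<close>.
\<close>

definition mellin_continuation ::
    "(real \<Rightarrow> complex) \<Rightarrow> (real \<Rightarrow> complex) \<Rightarrow> 'i set \<Rightarrow> ('i \<Rightarrow> real) \<Rightarrow> ('i \<Rightarrow> complex) \<Rightarrow> ('i \<Rightarrow> complex) \<Rightarrow> complex \<Rightarrow> complex"
  where "mellin_continuation h R J \<beta> A B s =
    (LINT t:{0<..1}|lborel. of_real t powr (-s-1) * h t) +
    (LINT t:{1<..}|lborel. of_real t powr (-s-1) * R t) +
    (\<Sum>j\<in>J. A j / (s - of_real (\<beta> j)) + B j / (s - of_real (\<beta> j))\<^sup>2)"

lemma mellin_of_power_log:
  fixes A B :: complex
  assumes "\<beta> < r"
  shows "set_integrable lborel {1<..} (\<lambda>t. of_real t powr (- of_real r - 1) * (of_real (t powr \<beta>) * (A + B * of_real (ln t))))"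
    and "(LINT t:{1<..}|lborel. of_real t powr (- of_real r - 1) * (of_real (t powr \<beta>) * (A + B * of_real (ln t)))) =
           A / (of_real r - of_real \<beta>) + B / (of_real r - of_real \<beta>)\<^sup>2"
proof -
  define c where "c = r - \<beta>"
  have c: "c > 0" using assms by (simp add: c_def)
  note I = integral_powr_Ioi[OF c]
  have eq: "of_real t powr (- of_real r - 1) * (of_real (t powr \<beta>) * (A + B * of_real (ln t))) =
      A * complex_of_real (t powr (- c - 1)) + B * complex_of_real (t powr (- c - 1) * ln t)" if "t \<in> {1<..}" for t
  proof -
    have "of_real t powr (- of_real r - 1 :: complex) = of_real (t powr (- r - 1))"
      using powr_of_real[of t "- r - 1"] that by simp
    moreover have "t powr (- r - 1) * t powr \<beta> = t powr (- c - 1)"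
      by (subst powr_add[symmetric]) (simp add: c_def algebra_simps)
    hence "of_real (t powr (- r - 1)) * of_real (t powr \<beta>) = complex_of_real (t powr (- c - 1))"
      by (simp flip: of_real_mult)
    ultimately show ?thesis by (simp add: algebra_simps)
  qed
  have J: "set_integrable lborel {1<..} (\<lambda>t. complex_of_real (t powr (- c - 1)))"
    "set_integrable lborel {1<..} (\<lambda>t. complex_of_real (t powr (- c - 1) * ln t))"
    using integrable_of_real[OF I(1)[unfolded set_integrable_def], where 'a = complex]
      integrable_of_real[OF I(3)[unfolded set_integrable_def], where 'a = complex]
    unfolding set_integrable_def by (simp_all add: scaleR_conv_of_real)
  have K: "set_integrable lborel {1<..} (\<lambda>t. A * complex_of_real (t powr (- c - 1)))"
    "set_integrable lborel {1<..} (\<lambda>t. B * complex_of_real (t powr (- c - 1) * ln t))"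
    using J by auto
  show "set_integrable lborel {1<..} (\<lambda>t. of_real t powr (- of_real r - 1) * (of_real (t powr \<beta>) * (A + B * of_real (ln t))))"
    by (subst set_integrable_cong[OF refl refl eq]) (use set_integral_add(1)[OF K] in auto)
  have "(LINT t:{1<..}|lborel. of_real t powr (- of_real r - 1) * (of_real (t powr \<beta>) * (A + B * of_real (ln t)))) =
        (LINT t:{1<..}|lborel. A * complex_of_real (t powr (- c - 1)) + B * complex_of_real (t powr (- c - 1) * ln t))"
    by (rule set_lebesgue_integral_cong) (use eq in auto)
  also have "\<dots> = A * (LINT t:{1<..}|lborel. complex_of_real (t powr (- c - 1))) +
                 B * (LINT t:{1<..}|lborel. complex_of_real (t powr (- c - 1) * ln t))"
    using set_integral_add(2)[OF K] by simp
  also have "\<dots> = A * of_real (1 / c) + B * of_real (1 / c\<^sup>2)"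
    unfolding set_integral_complex_of_real I ..
  finally show "(LINT t:{1<..}|lborel. of_real t powr (- of_real r - 1) * (of_real (t powr \<beta>) * (A + B * of_real (ln t)))) =
           A / (of_real r - of_real \<beta>) + B / (of_real r - of_real \<beta>)\<^sup>2"
    by (simp add: c_def)
qed

lemma mellin_eq_mellin_continuation:
  fixes r :: real
  assumes h: "continuous_on {0<..} h" and h0: "\<And>t. 0 < t \<Longrightarrow> t \<le> 1 \<Longrightarrow> norm (h t) \<le> K * t powr P"
    and R: "continuous_on {0<..} R" and R1: "\<And>t. 1 < t \<Longrightarrow> norm (R t) \<le> K' * t powr \<sigma>"
    and J: "finite J"
    and expansion: "\<And>t. 1 < t \<Longrightarrow> h t = R t + (\<Sum>j\<in>J. of_real (t powr \<beta> j) * (A j + B j * of_real (ln t)))"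
    and r: "\<sigma> < r" "r < P" "\<And>j. j \<in> J \<Longrightarrow> \<beta> j < r"
  shows "(LINT t:{0<..}|lborel. of_real t powr (- of_real r - 1) * h t) = mellin_continuation h R J \<beta> A B (of_real r)"
proof -
  let ?w = "\<lambda>t::real. of_real t powr (- of_real r - 1) :: complex"
  let ?E = "\<lambda>j t. ?w t * (of_real (t powr \<beta> j) * (A j + B j * of_real (ln t)))"
  have i0: "set_integrable lborel {0<..1} (\<lambda>t. ?w t * h t)"
    using set_integrable_mellin_0[OF h h0, of "of_real r"] r by simp
  have iR: "set_integrable lborel {1<..} (\<lambda>t. ?w t * R t)"
    using set_integrable_mellin_inf[OF R R1, of "of_real r"] r by simp
  have iE: "set_integrable lborel {1<..} (?E j)" if "j \<in> J" for j
    by (rule mellin_of_power_log(1)) (use r that in auto)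
  have iS: "set_integrable lborel {1<..} (\<lambda>t. \<Sum>j\<in>J. ?E j t)"
    using iE unfolding set_integrable_def by (simp add: scaleR_sum_right)
  have eq: "?w t * h t = ?w t * R t + (\<Sum>j\<in>J. ?E j t)" if "t \<in> {1<..}" for t
    using expansion[of t] that by (simp add: distrib_left sum_distrib_left)
  have i1: "set_integrable lborel {1<..} (\<lambda>t. ?w t * h t)"
    by (subst set_integrable_cong[OF refl refl eq]) (use set_integral_add(1)[OF iR iS] in auto)
  have "(LINT t:{0<..}|lborel. ?w t * h t) = (LINT t:{0<..1} \<union> {1<..}|lborel. ?w t * h t)"
    by (rule arg_cong[of _ _ "\<lambda>T. LINT t:T|lborel. ?w t * h t"]) auto
  also have "\<dots> = (LINT t:{0<..1}|lborel. ?w t * h t) + (LINT t:{1<..}|lborel. ?w t * h t)"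
    by (rule set_integral_Un[OF _ i0 i1]) auto
  also have "(LINT t:{1<..}|lborel. ?w t * h t) = (LINT t:{1<..}|lborel. ?w t * R t + (\<Sum>j\<in>J. ?E j t))"
    by (rule set_lebesgue_integral_cong) (use eq in auto)
  also have "\<dots> = (LINT t:{1<..}|lborel. ?w t * R t) + (LINT t:{1<..}|lborel. \<Sum>j\<in>J. ?E j t)"
    by (rule set_integral_add(2)[OF iR iS])
  also have "(LINT t:{1<..}|lborel. \<Sum>j\<in>J. ?E j t) = (\<Sum>j\<in>J. LINT t:{1<..}|lborel. ?E j t)"
    using iE unfolding set_integrable_def set_lebesgue_integral_def scaleR_sum_right
    by (rule Bochner_Integration.integral_sum)
  also have "\<dots> = (\<Sum>j\<in>J. A j / (of_real r - of_real (\<beta> j)) + B j / (of_real r - of_real (\<beta> j))\<^sup>2)"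
    by (intro sum.cong refl mellin_of_power_log(2) r)
  finally show ?thesis by (simp add: mellin_continuation_def)
qed

section \<open>A double zero against poles at zero\<close>

text \<open>
  The prefactor of the Mellin transform contains \<open>s sin (\<pi> s)\<close>. Removing its zero at \<open>0\<close> leaves
  an even function, whence the derivative \<open>0\<close>.
\<close>

lemma sin_over_linear:
  obtains g where "g holomorphic_on UNIV" "g 0 = 1" "deriv g 0 = 0"
    "\<And>s. sin (of_real pi * s) = of_real pi * s * g s"
proof -
  define g where "g s = (if s = 0 then deriv (\<lambda>s. sin (of_real pi * s)) 0
    else (sin (of_real pi * s) - sin (of_real pi * 0)) / (s - 0)) / of_real pi" for s :: complex
  have d: "deriv (\<lambda>s. sin (of_real pi * s)) 0 = complex_of_real pi"
    by (rule DERIV_imp_deriv) (auto intro!: derivative_eq_intros)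
  have hol: "g holomorphic_on UNIV"
    unfolding g_def by (intro holomorphic_on_divide pole_lemma holomorphic_intros) auto
  have g0: "g 0 = 1" by (simp add: g_def d)
  have even: "g (- s) = g s" for s by (simp add: g_def)
  have "(g has_field_derivative deriv g 0) (at 0)"
    using hol holomorphic_derivI by blast
  hence 1: "(g has_field_derivative deriv g 0) (at (- 0))" by simp
  have "((\<lambda>s. g (- s)) has_field_derivative deriv g 0 * (-1)) (at 0)"
    by (rule DERIV_chain2[where g = uminus, OF 1]) (auto intro!: derivative_eq_intros)
  hence "(g has_field_derivative deriv g 0 * (-1)) (at 0)" by (simp add: even)
  hence "deriv g 0 = deriv g 0 * (-1)" by (rule DERIV_imp_deriv)
  hence "deriv g 0 = 0" by simp
  moreover have "sin (of_real pi * s) = of_real pi * s * g s" for s by (simp add: g_def d)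
  ultimately show ?thesis using hol g0 that by blast
qed

text \<open>
  The factor \<open>s\<^sup>2\<close> cancels the poles at \<open>0\<close>, which come from the indices with \<open>\<beta> j = 0\<close>. The
  function \<open>W\<close> is \<open>s\<^sup>2 E Q' + E (s D A + D B)\<close> with \<open>E = g exp (- c s)\<close>, where \<open>Q'\<close> collects \<open>Q\<close> and
  the terms with \<open>\<beta> j \<noteq> 0\<close>. As \<open>E = 1 - c s + \<dots>\<close>, the holomorphic part \<open>Q'\<close> is not visible in
  \<open>W\<close> to first order.
\<close>

lemma double_pole_times_double_zero:
  fixes c :: complex and J :: "'i set" and \<beta> :: "'i \<Rightarrow> real" and A B :: "'i \<Rightarrow> complex"
  assumes J: "finite J" and U: "open U" "0 \<in> U" and Q: "Q holomorphic_on U"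
    and g: "g holomorphic_on UNIV" "g 0 = 1" "deriv g 0 = 0"
  defines "D \<equiv> \<lambda>X. \<Sum>j\<in>{j\<in>J. \<beta> j = 0}. X j"
  obtains W where "W analytic_on {0}" "W 0 = D B" "deriv W 0 = D A - c * D B"
    "\<forall>\<^sub>F s in at 0. W s = s\<^sup>2 * g s * exp (- c * s) *
       (Q s + (\<Sum>j\<in>J. A j / (s - of_real (\<beta> j)) + B j / (s - of_real (\<beta> j))\<^sup>2))"
proof -
  define E where "E s = g s * exp (- c * s)" for s
  define I where "I = {j\<in>J. \<beta> j = 0}"
  define I' where "I' = {j\<in>J. \<beta> j \<noteq> 0}"
  define Q' where "Q' s = Q s + (\<Sum>j\<in>I'. A j / (s - of_real (\<beta> j)) + B j / (s - of_real (\<beta> j))\<^sup>2)" for s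
  define V where "V = U - of_real ` (\<beta> ` I')"
  have fI: "finite I" "finite I'" using J by (auto simp: I_def I'_def)
  have V: "open V" "0 \<in> V" using U fI by (auto simp: V_def I'_def intro!: open_Diff finite_imp_closed)
  have Q': "Q' holomorphic_on V"
    unfolding Q'_def by (intro holomorphic_intros holomorphic_on_subset[OF Q]) (auto simp: V_def)
  have E: "E holomorphic_on V"
    unfolding E_def by (intro holomorphic_intros holomorphic_on_subset[OF g(1)]) auto
  define W where "W s = s\<^sup>2 * E s * Q' s + E s * (s * D A + D B)" for s
  have W: "W holomorphic_on V"
    unfolding W_def by (intro holomorphic_intros E Q')
  have dE: "(E has_field_derivative - c) (at 0)"
  proof -
    have "(g has_field_derivative 0) (at 0)"
      using g holomorphic_derivI[of g UNIV 0] by simp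
    thus ?thesis unfolding E_def by (auto intro!: derivative_eq_intros simp: g(2))
  qed
  have dQ: "(Q' has_field_derivative deriv Q' 0) (at 0)"
    using Q' V holomorphic_derivI by blast
  have "(W has_field_derivative D A - c * D B) (at 0)"
    unfolding W_def by (rule derivative_eq_intros refl dE dQ)+ (simp add: E_def g(2))
  hence "deriv W 0 = D A - c * D B" by (rule DERIV_imp_deriv)
  moreover have "W 0 = D B" by (simp add: W_def E_def g(2))
  moreover have "W analytic_on {0}"
    using W V analytic_at by blast
  moreover have "\<forall>\<^sub>F s in at 0. W s = s\<^sup>2 * g s * exp (- c * s) *
       (Q s + (\<Sum>j\<in>J. A j / (s - of_real (\<beta> j)) + B j / (s - of_real (\<beta> j))\<^sup>2))"
  proof (rule eventually_mono)
    show "\<forall>\<^sub>F s in at (0::complex). s \<noteq> 0" by (simp add: eventually_at_filter)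
    fix s :: complex assume s: "s \<noteq> 0"
    have "(\<Sum>j\<in>J. A j / (s - of_real (\<beta> j)) + B j / (s - of_real (\<beta> j))\<^sup>2) =
      (\<Sum>j\<in>I. A j / (s - of_real (\<beta> j)) + B j / (s - of_real (\<beta> j))\<^sup>2) +
      (\<Sum>j\<in>I'. A j / (s - of_real (\<beta> j)) + B j / (s - of_real (\<beta> j))\<^sup>2)"
      using fI by (subst sum.union_disjoint[symmetric]) (auto simp: I_def I'_def intro!: sum.cong)
    also have "(\<Sum>j\<in>I. A j / (s - of_real (\<beta> j)) + B j / (s - of_real (\<beta> j))\<^sup>2) =
      (\<Sum>j\<in>I. A j / s + B j / s\<^sup>2)"
      by (intro sum.cong) (auto simp: I_def)
    also have "\<dots> = D A / s + D B / s\<^sup>2"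
      unfolding D_def I_def[symmetric] by (simp add: sum.distrib sum_divide_distrib)
    finally have eq: "Q s + (\<Sum>j\<in>J. A j / (s - of_real (\<beta> j)) + B j / (s - of_real (\<beta> j))\<^sup>2) =
       Q' s + (D A / s + D B / s\<^sup>2)" by (simp add: Q'_def)
    show "W s = s\<^sup>2 * g s * exp (- c * s) *
       (Q s + (\<Sum>j\<in>J. A j / (s - of_real (\<beta> j)) + B j / (s - of_real (\<beta> j))\<^sup>2))"
      unfolding eq W_def E_def using s by (simp add: field_simps power2_eq_square)
  qed
  ultimately show ?thesis using that by blast
qed

section \<open>Admissible sequences and their zeta series\<close>

locale admissible =
  fixes a :: "nat \<Rightarrow> complex" and \<alpha> \<Psi> \<epsilon> :: real
  assumes admissible: "admissible_sequence a \<alpha> \<Psi> \<epsilon>"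
begin

abbreviation genus :: nat where "genus \<equiv> nat \<lfloor>\<alpha>\<rfloor>"

lemma norm_a_mono: "norm (a 1) \<le> norm (a (Suc n))"
proof (induction n)
  case (Suc n)
  have "norm (a (Suc n)) \<le> norm (a (Suc (Suc n)))"
    using admissible unfolding admissible_sequence_def by simp
  with Suc show ?case by simp
qed simp

lemma a_nonzero: "a (Suc n) \<noteq> 0"
proof -
  have "0 < norm (a 1)" using admissible unfolding admissible_sequence_def by blast
  with norm_a_mono[of n] show ?thesis by auto
qed

lemma a_notin_sector: "a (Suc n) \<notin> sector \<Psi> \<epsilon>"
  using admissible unfolding admissible_sequence_def by simp

lemma norm_a_at_top: "filterlim (\<lambda>n. norm (a n)) at_top sequentially"
  using admissible unfolding admissible_sequence_def by blast

lemma limsup_eq: "limsup (\<lambda>n. ereal (ln (real n) / ln (norm (a n)))) = ereal \<alpha>"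
  using admissible unfolding admissible_sequence_def exponent_of_convergence_def by blast

lemma alpha_nonneg: "\<alpha> \<ge> 0"
proof -
  \<comment> \<open>the quotients of logarithms are nonnegative from here on\<close>
  have "\<forall>\<^sub>F n in sequentially. norm (a n) \<ge> 1"
    using norm_a_at_top by (auto simp: filterlim_at_top)
  hence "\<forall>\<^sub>F n in sequentially. 0 \<le> ereal (ln (real n) / ln (norm (a n)))"
    using eventually_ge_at_top[of 1]
    by eventually_elim (auto intro!: divide_nonneg_nonneg)
  hence "0 \<le> liminf (\<lambda>n. ereal (ln (real n) / ln (norm (a n))))"
    by (rule Liminf_bounded)
  also have "\<dots> \<le> limsup (\<lambda>n. ereal (ln (real n) / ln (norm (a n))))"
    by (rule Liminf_le_Limsup) auto
  finally show ?thesis by (simp add: limsup_eq)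
qed

lemma genus_bounds: "real genus \<le> \<alpha>" "\<alpha> < real genus + 1"
  using alpha_nonneg by (auto simp: of_nat_nat)

text \<open>
  For \<open>s\<close> strictly between \<open>\<alpha>\<close> and \<open>r\<close>, eventually \<open>n < \<bar>a n\<bar>^s\<close>, which bounds the terms by
  those of the convergent series of \<open>n^(- r/s)\<close>.
\<close>

lemma summable_norm_a_powr:
  assumes "\<alpha> < r"
  shows "summable (\<lambda>n. norm (a (Suc n)) powr (- r))"
proof -
  define s where "s = (\<alpha> + r) / 2"
  have s: "\<alpha> < s" "s < r" "s > 0" using assms alpha_nonneg by (auto simp: s_def)
  have "limsup (\<lambda>n. ereal (ln (real n) / ln (norm (a n)))) < ereal s"
    using s by (simp add: limsup_eq)
  hence "\<forall>\<^sub>F n in sequentially. ereal (ln (real n) / ln (norm (a n))) < ereal s"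
    by (rule Limsup_lessD)
  moreover have "\<forall>\<^sub>F n in sequentially. norm (a n) > 1"
    using norm_a_at_top by (auto simp: filterlim_at_top_dense)
  ultimately have "\<forall>\<^sub>F n in sequentially. norm (norm (a n) powr (- r)) \<le> real n powr (- (r / s))"
    using eventually_ge_at_top[of 1]
  proof eventually_elim
    case (elim n)
    have "ln (norm (a n)) > 0" using elim by (intro ln_gt_zero) auto
    hence "ln (real n) < s * ln (norm (a n))"
      using elim pos_divide_less_eq[of "ln (norm (a n))" "ln (real n)" s] by simp
    hence "ln (real n) / s \<le> ln (norm (a n))" using s by (simp add: pos_divide_le_eq mult.commute)
    hence "r * (ln (real n) / s) \<le> r * ln (norm (a n))"
      using s by (intro mult_left_mono) auto
    hence "exp (- r * ln (norm (a n))) \<le> exp (- (r / s) * ln (real n))" by simp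
    moreover have "norm (a n) \<noteq> 0" using elim by linarith
    ultimately show ?case using elim by (simp add: powr_def)
  qed
  moreover have "summable (\<lambda>n. real n powr (- (r / s)))"
    using s by (subst summable_real_powr_iff) (auto simp: field_simps)
  ultimately have "summable (\<lambda>n. norm (a n) powr (- r))"
    by (rule summable_comparison_test_ev)
  thus ?thesis by (subst summable_Suc_iff)
qed

text \<open>
  On the ray \<open>z = t exp (\<i> \<Psi>)\<close> the factors of the canonical product are evaluated at
  \<open>z / a (n + 1) = t * b n\<close>.
\<close>

definition b :: "nat \<Rightarrow> complex" where "b n = cis \<Psi> / a (Suc n)"

lemma norm_b: "norm (b n) = 1 / norm (a (Suc n))"
  by (simp add: b_def norm_divide)

lemma b_nonzero: "b n \<noteq> 0"
  using a_nonzero by (auto simp: b_def)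

lemma summable_norm_b_powr:
  assumes "\<alpha> < r"
  shows "summable (\<lambda>n. norm (b n) powr r)"
  using summable_norm_a_powr[OF assms] a_nonzero
  by (simp add: norm_b powr_divide powr_minus_divide)

text \<open>
  As all \<open>a n\<close> stay out of the sector, the argument of each \<open>b n\<close> is at least \<open>\<epsilon>\<close> in absolute
  value. Existence of a single such number forces \<open>\<epsilon> \<le> \<pi>\<close>, hence \<open>cos \<epsilon> < 1\<close>.
\<close>

lemma Re_b_le: "Re (b n) \<le> max 0 (cos \<epsilon>) * norm (b n)" and cos_eps: "max 0 (cos \<epsilon>) < 1"
proof -
  have *: "\<epsilon> \<le> \<bar>Arg (b n)\<bar>" for n
  proof (rule ccontr)
    assume "\<not> \<epsilon> \<le> \<bar>Arg (b n)\<bar>"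
    hence A: "\<Psi> - \<epsilon> < \<Psi> - Arg (b n)" "\<Psi> - Arg (b n) < \<Psi> + \<epsilon>" by (auto simp: abs_if split: if_splits)
    have "a (Suc n) = cis \<Psi> / b n" using a_nonzero by (simp add: b_def)
    also have "b n = of_real (norm (b n)) * cis (Arg (b n))"
      using Arg_eq[OF b_nonzero, of n] by (simp add: cis_conv_exp)
    also have "cis \<Psi> / (of_real (norm (b n)) * cis (Arg (b n))) = of_real (norm (a (Suc n))) * cis (\<Psi> - Arg (b n))"
      by (simp add: norm_b cis_divide[symmetric])
    finally have "is_Arg (a (Suc n)) (\<Psi> - Arg (b n))"
      by (simp add: is_Arg_def cis_conv_exp)
    thus False using A a_nonzero a_notin_sector unfolding sector_def by blast
  qed
  have eps: "0 < \<epsilon>" using admissible by (simp add: admissible_sequence_def)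
  have le: "\<bar>Arg (b n)\<bar> \<le> pi" for n using mpi_less_Arg[of "b n"] Arg_le_pi[of "b n"] by auto
  have "\<epsilon> \<le> pi" using *[of 0] le[of 0] by linarith
  have "cos \<epsilon> < cos 0" by (rule cos_monotone_0_pi) (use eps \<open>\<epsilon> \<le> pi\<close> in auto)
  thus "max 0 (cos \<epsilon>) < 1" by simp
  have "Re (b n) = norm (b n) * cos \<bar>Arg (b n)\<bar>"
    using rcis_cmod_Arg[of "b n"] by (metis Re_rcis cos_abs_real)
  also have "\<dots> \<le> norm (b n) * cos \<epsilon>"
    using *[of n] le[of n] eps by (intro mult_left_mono cos_monotone_0_pi_le) auto
  also have "\<dots> \<le> norm (b n) * max 0 (cos \<epsilon>)" by (intro mult_left_mono) auto
  finally show "Re (b n) \<le> max 0 (cos \<epsilon>) * norm (b n)" by (simp add: mult.commute)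
qed

lemma b_notin_nonneg_Reals: "b n \<notin> \<real>\<^sub>\<ge>\<^sub>0"
proof
  assume b: "b n \<in> \<real>\<^sub>\<ge>\<^sub>0"
  then obtain x where x: "b n = of_real x" "x \<ge> 0" by (auto elim: nonneg_Reals_cases)
  hence "x \<le> max 0 (cos \<epsilon>) * x" "x \<noteq> 0" using Re_b_le[of n] b_nonzero[of n] by auto
  thus False using cos_eps x mult_strict_right_mono[of "max 0 (cos \<epsilon>)" 1 x] by auto
qed

lemma quotient_notin_nonneg_Reals:
  assumes "z \<in> sector \<Psi> \<epsilon>"
  shows "z / a (Suc n) \<notin> \<real>\<^sub>\<ge>\<^sub>0"
proof
  assume "z / a (Suc n) \<in> \<real>\<^sub>\<ge>\<^sub>0"
  then obtain x where x: "z / a (Suc n) = of_real x" "x \<ge> 0" by (auto elim: nonneg_Reals_cases)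
  obtain \<theta> where \<theta>: "z \<noteq> 0" "\<Psi> - \<epsilon> < \<theta>" "\<theta> < \<Psi> + \<epsilon>" "is_Arg z \<theta>"
    using assms by (auto simp: sector_def)
  have "x \<noteq> 0" using x \<theta> a_nonzero by auto
  hence x0: "x > 0" using x by auto
  have "a (Suc n) = z / of_real x" using x x0 a_nonzero by (auto simp: field_simps)
  hence "is_Arg (a (Suc n)) \<theta>" using \<theta>(4) x0 by (simp add: is_Arg_def norm_divide)
  thus False using \<theta> a_nonzero a_notin_sector unfolding sector_def by blast
qed

lemma ray_in_sector: "t > 0 \<Longrightarrow> of_real t * cis \<Psi> \<in> sector \<Psi> \<epsilon>"
proof -
  assume t: "t > 0"
  hence "is_Arg (of_real t * cis \<Psi>) \<Psi>" by (simp add: is_Arg_def norm_mult cis_conv_exp)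
  moreover have "0 < \<epsilon>" using admissible by (simp add: admissible_sequence_def)
  ultimately show ?thesis using t unfolding sector_def by (auto intro!: exI[of _ \<Psi>])
qed

text \<open>
  The arguments in the branch of \<open>a n^(-s)\<close> are bounded, so on bounded sets of \<open>s\<close> the terms
  are comparable with \<open>\<bar>a n\<bar>^(- Re s)\<close>.
\<close>

lemma zeta_series_holomorphic: "zeta_series a \<Psi> holomorphic_on {s. \<alpha> < Re s}"
  and summable_zeta_series: "\<alpha> < Re s \<Longrightarrow> summable (\<lambda>n. norm (powr_near (\<Psi> - pi) (a (Suc n)) (- s)))"
proof -
  define T where "T = \<bar>\<Psi> - pi\<bar> + pi"
  \<comment> \<open>finitely many \<open>a n\<close> may have norm below \<open>1\<close>, where powers grow with the negative exponent\<close>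
  define m where "m = min 1 (norm (a 1))"
  have m: "0 < m" "m \<le> 1" using a_nonzero[of 0] by (auto simp: m_def)
  have nrm: "norm (powr_near (\<Psi> - pi) (a (Suc n)) (- s)) \<le>
      norm (a (Suc n)) powr (- \<sigma>) * (m powr (- d) * exp (K * T))"
    if "\<sigma> \<le> Re s" "Re s \<le> \<sigma> + d" "\<bar>Im s\<bar> \<le> K" for n s \<sigma> d K
  proof -
    let ?A = "norm (a (Suc n))" and ?\<theta> = "arg_near (\<Psi> - pi) (a (Suc n))"
    have A: "?A > 0" using a_nonzero by auto
    have mA: "m \<le> ?A" using norm_a_mono[of n] by (auto simp: m_def)
    have \<theta>: "\<bar>?\<theta>\<bar> \<le> T" using arg_near_bounds[where c = "\<Psi> - pi" and z = "a (Suc n)"] by (auto simp: T_def)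
    have "norm (powr_near (\<Psi> - pi) (a (Suc n)) (- s)) = ?A powr (- Re s) * exp (Im s * ?\<theta>)"
      using A by (simp add: powr_near_def ln_near_def powr_def exp_add[symmetric])
    also have "?A powr (- Re s) = ?A powr (- \<sigma>) * ?A powr (- (Re s - \<sigma>))"
      by (simp add: powr_add[symmetric])
    also have "?A powr (- \<sigma>) * ?A powr (- (Re s - \<sigma>)) * exp (Im s * ?\<theta>) \<le>
                 ?A powr (- \<sigma>) * m powr (- d) * exp (K * T)"
    proof (intro mult_mono order.refl)
      have "?A powr (- (Re s - \<sigma>)) \<le> m powr (- (Re s - \<sigma>))"
        using that mA m by (intro powr_mono2') auto
      also have "\<dots> \<le> m powr (- d)"
        using that m by (intro powr_mono') auto
      finally show "?A powr (- (Re s - \<sigma>)) \<le> m powr (- d)" .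
      have "Im s * ?\<theta> \<le> \<bar>Im s\<bar> * \<bar>?\<theta>\<bar>" by (metis abs_ge_self abs_mult)
      also have "\<dots> \<le> K * T" using that \<theta> by (intro mult_mono) auto
      finally show "exp (Im s * ?\<theta>) \<le> exp (K * T)" by simp
    qed auto
    finally show ?thesis by (simp add: mult.assoc)
  qed
  have dom: "summable (\<lambda>n. norm (a (Suc n)) powr (- \<sigma>) * (m powr (- d) * exp (K * T)))" if "\<alpha> < \<sigma>" for \<sigma> d K
    using summable_norm_a_powr[OF that] by (rule summable_mult2)
  show sum: "summable (\<lambda>n. norm (powr_near (\<Psi> - pi) (a (Suc n)) (- s)))" if "\<alpha> < Re s" for s
    by (rule summable_comparison_test'[OF dom[OF that, of 0 "\<bar>Im s\<bar>"]])
       (use nrm[of "Re s" s 0 "\<bar>Im s\<bar>"] in simp)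
  have "(\<lambda>s. LINT n|count_space UNIV. powr_near (\<Psi> - pi) (a (Suc n)) (- s)) holomorphic_on {s. \<alpha> < Re s}"
  proof (rule holomorphic_integral)
    fix s0 assume "s0 \<in> {s. \<alpha> < Re s}"
    define \<sigma> where "\<sigma> = (Re s0 + \<alpha>) / 2"
    define d where "d = Re s0 - \<sigma>"
    have \<sigma>: "\<alpha> < \<sigma>" "d > 0" using \<open>s0 \<in> _\<close> by (auto simp: \<sigma>_def d_def field_simps)
    define g where "g n = norm (a (Suc n)) powr (- \<sigma>) * (m powr (- (2 * d)) * exp ((\<bar>Im s0\<bar> + d) * T))" for n
    have "integrable (count_space UNIV) g"
      unfolding integrable_count_space_nat_iff g_def using dom[OF \<sigma>(1)]
      by (simp add: abs_mult)
    moreover have "norm (powr_near (\<Psi> - pi) (a (Suc n)) (- s)) \<le> g n" if "s \<in> ball s0 d" for n s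
      unfolding g_def
    proof (rule nrm)
      have "\<bar>Re s - Re s0\<bar> < d" "\<bar>Im s - Im s0\<bar> < d"
        using that abs_Re_le_cmod[of "s - s0"] abs_Im_le_cmod[of "s - s0"]
        by (auto simp: dist_norm norm_minus_commute)
      thus "\<sigma> \<le> Re s" "Re s \<le> \<sigma> + 2 * d" "\<bar>Im s\<bar> \<le> \<bar>Im s0\<bar> + d"
        by (auto simp: d_def abs_if split: if_splits)
    qed
    ultimately show "\<exists>d>0. \<exists>g. integrable (count_space UNIV) g \<and> (\<forall>n\<in>space (count_space UNIV). \<forall>s\<in>ball s0 d.
        s \<in> {s. \<alpha> < Re s} \<longrightarrow> norm (powr_near (\<Psi> - pi) (a (Suc n)) (- s)) \<le> g n)"
      using \<sigma> by (intro exI[of _ d] exI[of _ g] conjI) auto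
  qed (auto simp: powr_near_def open_halfspace_Re_gt intro!: holomorphic_intros)
  moreover have "zeta_series a \<Psi> s = (LINT n|count_space UNIV. powr_near (\<Psi> - pi) (a (Suc n)) (- s))"
    if "s \<in> {s. \<alpha> < Re s}" for s
    using that by (simp add: zeta_series_def integral_count_space_nat integrable_count_space_nat_iff sum)
  ultimately show "zeta_series a \<Psi> holomorphic_on {s. \<alpha> < Re s}"
    using holomorphic_cong by (metis (no_types, lifting))
qed

section \<open>The logarithm of the canonical product\<close>

text \<open>
  The logarithm of the canonical product that vanishes at \<open>0\<close>.
\<close>

definition log_product :: "complex \<Rightarrow> complex" where
  "log_product z = (\<Sum>n. log_weierstrass genus (z / a (Suc n)))"

text \<open>
  For terms with \<open>2 \<bar>z\<bar> \<le> \<bar>a n\<bar>\<close> the factor \<open>1 - u z / a n\<close> is bounded below without any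
  condition on the direction of \<open>z\<close>; this gives uniform convergence on bounded sets.
\<close>

lemma norm_log_weierstrass_quotient_le:
  assumes "norm z \<le> R" "2 * R \<le> norm (a (Suc n))"
  shows "norm (log_weierstrass genus (z / a (Suc n))) \<le>
           R powr (real genus + 1) / (1 / 3 * (real genus + 1)) * norm (a (Suc n)) powr (- (real genus + 1))"
proof -
  have R: "R \<ge> 0" using assms(1) norm_ge_zero order_trans by blast
  have a0: "norm (a (Suc n)) > 0" using a_nonzero by auto
  have w: "norm (z / a (Suc n)) \<le> 1 / 2"
    using assms a0 by (simp add: norm_divide pos_divide_le_eq)
  have "norm (log_weierstrass genus (z / a (Suc n))) \<le>
          norm (z / a (Suc n)) powr (real genus + 1) / (1 / 3 * (real genus + 1))"
  proof (rule norm_log_weierstrass_le)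
    fix u :: real assume u: "0 \<le> u" "u \<le> 1"
    have "u * norm (z / a (Suc n)) \<le> 1 * (1 / 2)" using u w by (intro mult_mono) auto
    moreover have "norm (1 - of_real u * (z / a (Suc n))) \<ge> norm (1::complex) - norm (of_real u * (z / a (Suc n)))"
      by (rule norm_triangle_ineq2)
    moreover have "norm (of_real u * (z / a (Suc n))) = u * norm (z / a (Suc n))"
      using u by (simp add: norm_mult norm_divide)
    ultimately show "1 / 3 * (1 + u * norm (z / a (Suc n))) \<le> norm (1 - of_real u * (z / a (Suc n)))"
      by simp
  qed auto
  also have "\<dots> \<le> (R / norm (a (Suc n))) powr (real genus + 1) / (1 / 3 * (real genus + 1))"
    using assms a0 by (intro divide_right_mono powr_mono2) (auto simp: norm_divide intro!: divide_right_mono)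
  also have "(R / norm (a (Suc n))) powr (real genus + 1) =
      R powr (real genus + 1) * norm (a (Suc n)) powr (- (real genus + 1))"
    using R a0 powr_minus_divide[of "norm (a (Suc n))" "real genus + 1"] by (subst powr_divide) auto
  finally show ?thesis by (simp add: mult_ac)
qed

lemma eventually_norm_a_ge: "\<exists>n0. \<forall>n\<ge>n0. R \<le> norm (a (Suc n))"
proof -
  have "\<forall>\<^sub>F n in sequentially. R \<le> norm (a n)"
    using norm_a_at_top by (auto simp: filterlim_at_top)
  then obtain N where "\<And>n. n \<ge> N \<Longrightarrow> R \<le> norm (a n)"
    by (auto simp: eventually_sequentially)
  thus ?thesis by (intro exI[of _ N]) auto
qed

lemma summable_log_weierstrass: "summable (\<lambda>n. log_weierstrass genus (z / a (Suc n)))"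
proof -
  obtain n0 where n0: "\<And>n. n \<ge> n0 \<Longrightarrow> 2 * norm z \<le> norm (a (Suc n))"
    using eventually_norm_a_ge by blast
  show ?thesis
  proof (rule summable_comparison_test')
    show "summable (\<lambda>n. norm z powr (real genus + 1) / (1 / 3 * (real genus + 1)) *
                       norm (a (Suc n)) powr (- (real genus + 1)))"
      by (intro summable_mult summable_norm_a_powr genus_bounds)
  qed (use norm_log_weierstrass_quotient_le[OF order.refl n0] in auto)
qed

text \<open>
  Off the rays through the \<open>a n\<close>, which the sector avoids, every term is continuous. The vertex
  is included, because \<open>ln F 0\<close> is found as a limit there.
\<close>

lemma continuous_on_log_product: "continuous_on (insert 0 (sector \<Psi> \<epsilon>)) log_product"
proof -
  let ?S = "insert 0 (sector \<Psi> \<epsilon>)"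
  have notin: "1 - z / a (Suc n) \<notin> \<real>\<^sub>\<le>\<^sub>0" if "z \<in> ?S" for z n
    using that quotient_notin_nonneg_Reals[of z n]
    by (cases "z = 0") (auto intro!: one_minus_notin_nonpos_Reals)
  have cont: "continuous_on ?S (\<lambda>z. log_weierstrass genus (z / a (Suc n)))" for n
    unfolding log_weierstrass_def using notin a_nonzero by (intro continuous_intros) auto
  have "continuous_on (?S \<inter> ball 0 R) log_product" for R
  proof -
    obtain n0 where n0: "\<And>n. n \<ge> n0 \<Longrightarrow> 2 * R \<le> norm (a (Suc n))"
      using eventually_norm_a_ge by blast
    let ?M = "\<lambda>n. R powr (real genus + 1) / (1 / 3 * (real genus + 1)) *
                    norm (a (Suc n)) powr (- (real genus + 1))"
    have "uniform_limit (?S \<inter> ball 0 R) (\<lambda>k z. \<Sum>n<k. log_weierstrass genus (z / a (Suc n))) log_product sequentially"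
      unfolding log_product_def
    proof (rule Weierstrass_m_test_ev)
      show "\<forall>\<^sub>F n in sequentially. \<forall>z\<in>?S \<inter> ball 0 R. norm (log_weierstrass genus (z / a (Suc n))) \<le> ?M n"
        using eventually_ge_at_top[of n0]
        by eventually_elim (use norm_log_weierstrass_quotient_le n0 in auto)
      show "summable ?M"
        by (intro summable_mult summable_norm_a_powr genus_bounds)
    qed
    thus ?thesis
      by (rule uniform_limit_theorem[rotated])
         (auto intro!: always_eventually continuous_on_sum continuous_on_subset[OF cont])
  qed
  hence *: "continuous_on (?S \<inter> ball 0 R) log_product" for R .
  show ?thesis
    unfolding continuous_on_eq_continuous_within
  proof
    fix z assume z: "z \<in> ?S"
    have "continuous (at z within (?S \<inter> ball 0 (norm z + 1))) log_product"
      using *[of "norm z + 1"] z by (auto simp: continuous_on_eq_continuous_within)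
    moreover have "at z within (?S \<inter> ball 0 (norm z + 1)) = at z within ?S"
      by (rule at_within_nhd[of _ "ball 0 (norm z + 1)"]) auto
    ultimately show "continuous (at z within ?S) log_product" by simp
  qed
qed

lemma log_product_0 [simp]: "log_product 0 = 0"
  by (simp add: log_product_def)

lemma exp_log_product:
  assumes "z \<in> sector \<Psi> \<epsilon>"
  shows "exp (log_product z) = canonical_product a \<alpha> z"
proof -
  have "z / a (Suc n) \<noteq> 1" for n
    using quotient_notin_nonneg_Reals[OF assms, of n] by force
  hence "canonical_product a \<alpha> z = prodinf (\<lambda>n. exp (log_weierstrass genus (z / a (Suc n))))"
    by (simp add: canonical_product_def exp_log_weierstrass)
  also have "\<dots> = exp (log_product z)"
    unfolding log_product_def by (rule prodinf_exp[OF summable_log_weierstrass])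
  finally show ?thesis ..
qed

lemma connected_sector: "connected (sector \<Psi> \<epsilon>)"
proof -
  have "sector \<Psi> \<epsilon> = (\<lambda>(t, \<theta>). of_real t * cis \<theta>) ` ({0<..} \<times> {\<Psi> - \<epsilon><..<\<Psi> + \<epsilon>})" (is "_ = ?f ` ?A")
  proof (intro equalityI subsetI)
    fix z assume "z \<in> sector \<Psi> \<epsilon>"
    then obtain \<theta> where "z \<noteq> 0" "\<Psi> - \<epsilon> < \<theta>" "\<theta> < \<Psi> + \<epsilon>" "is_Arg z \<theta>"
      by (auto simp: sector_def)
    thus "z \<in> ?f ` ?A"
      by (intro image_eqI[of _ _ "(norm z, \<theta>)"]) (auto simp: is_Arg_def cis_conv_exp)
  next
    fix z assume "z \<in> ?f ` ?A"
    then obtain t \<theta> where z: "z = of_real t * cis \<theta>" "t > 0" "\<Psi> - \<epsilon> < \<theta>" "\<theta> < \<Psi> + \<epsilon>" by auto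
    hence "is_Arg z \<theta>" by (simp add: is_Arg_def norm_mult cis_conv_exp)
    moreover have "z \<noteq> 0" using z by simp
    ultimately show "z \<in> sector \<Psi> \<epsilon>" using z(3,4) unfolding sector_def by blast
  qed
  moreover have "connected (?f ` ?A)"
  proof (rule connected_continuous_image)
    show "continuous_on ?A ?f"
      by (auto simp: case_prod_unfold cis_conv_exp intro!: continuous_intros)
    show "connected ?A" by (intro connected_Times) auto
  qed
  ultimately show ?thesis by simp
qed

text \<open>
  Two continuous logarithms of the same function on a connected set differ by a constant,
  because their difference takes values in the discrete set of multiples of \<open>2 \<pi> \<i>\<close>.
\<close>

lemma log_branch_eq:
  assumes \<omega>: "F = (\<lambda>z. exp (poly \<omega> z) * canonical_product a \<alpha> z)"
    and L: "L holomorphic_on sector \<Psi> \<epsilon>" "\<And>z. z \<in> sector \<Psi> \<epsilon> \<Longrightarrow> exp (L z) = F z"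
  obtains C where "\<And>z. z \<in> sector \<Psi> \<epsilon> \<Longrightarrow> L z = C + poly \<omega> z + log_product z"
proof -
  define D where "D z = L z - (poly \<omega> z + log_product z)" for z
  have D1: "exp (D z) = 1" if "z \<in> sector \<Psi> \<epsilon>" for z
  proof -
    have "exp (D z) = exp (L z) / (exp (poly \<omega> z) * exp (log_product z))"
      by (simp add: D_def exp_diff exp_add)
    also have "exp (log_product z) = canonical_product a \<alpha> z" by (rule exp_log_product[OF that])
    also have "exp (L z) = exp (poly \<omega> z) * canonical_product a \<alpha> z" using L(2)[OF that] \<omega> by simp
    also have "canonical_product a \<alpha> z \<noteq> 0" using exp_log_product[OF that] by (metis exp_not_eq_zero)
    ultimately show ?thesis by simp
  qed
  have "D constant_on sector \<Psi> \<epsilon>"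
  proof (rule continuous_discrete_range_constant[OF connected_sector])
    show "continuous_on (sector \<Psi> \<epsilon>) D"
      unfolding D_def
      by (intro continuous_intros holomorphic_on_imp_continuous_on[OF L(1)]
            continuous_on_subset[OF continuous_on_log_product]) auto
    fix z assume z: "z \<in> sector \<Psi> \<epsilon>"
    have "2 * pi \<le> norm (D y - D z)" if "y \<in> sector \<Psi> \<epsilon>" "D y \<noteq> D z" for y
    proof -
      have "exp (D y) = exp (D z)" using D1 z that by simp
      then obtain k :: int where k: "D y = D z + of_int (2 * k) * pi * \<i>" by (auto simp: exp_eq)
      have "k \<noteq> 0" using k that by auto
      hence "1 \<le> \<bar>k\<bar>" by linarith
      hence "1 \<le> \<bar>real_of_int k\<bar>" by linarith
      moreover have "norm (D y - D z) = 2 * pi * \<bar>real_of_int k\<bar>"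
        unfolding k by (simp add: norm_mult)
      ultimately show ?thesis by simp
    qed
    thus "\<exists>e>0. \<forall>y. y \<in> sector \<Psi> \<epsilon> \<and> D y \<noteq> D z \<longrightarrow> e \<le> norm (D y - D z)"
      by (intro exI[of _ "2 * pi"]) auto
  qed
  then obtain C where "\<And>z. z \<in> sector \<Psi> \<epsilon> \<Longrightarrow> D z = C" by (auto simp: constant_on_def)
  hence "\<And>z. z \<in> sector \<Psi> \<epsilon> \<Longrightarrow> L z = C + poly \<omega> z + log_product z"
    by (simp add: D_def algebra_simps)
  thus ?thesis by (rule that)
qed

section \<open>The Mellin transform along the ray\<close>

lemma log_product_ray: "log_product (of_real t * cis \<Psi>) = (\<Sum>n. log_weierstrass genus (of_real t * b n))"
  by (simp add: log_product_def b_def)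

lemma summable_log_weierstrass_ray: "summable (\<lambda>n. log_weierstrass genus (of_real t * b n))"
  using summable_log_weierstrass[of "of_real t * cis \<Psi>"] by (simp add: b_def)

lemma continuous_on_log_product_ray: "continuous_on {0<..} (\<lambda>t. log_product (of_real t * cis \<Psi>))"
  by (rule continuous_on_compose2[OF continuous_on_log_product])
     (auto intro!: continuous_intros ray_in_sector)

text \<open>
  The constant in the lower bound \<open>\<bar>1 - u b n\<bar> \<ge> cone_const (1 + u \<bar>b n\<bar>)\<close>.
\<close>

definition cone_const :: real where "cone_const = sqrt ((1 - max 0 (cos \<epsilon>)) / 2)"

lemma norm_log_weierstrass_b_le:
  assumes "t > 0" "\<alpha> < \<rho>" "\<rho> \<le> real genus + 1"
  shows "norm (log_weierstrass genus (of_real t * b n)) \<le> norm (b n) powr \<rho> / (cone_const * \<rho>) * t powr \<rho>"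
  unfolding cone_const_def
  by (rule norm_log_weierstrass_ray_le[OF _ cos_eps Re_b_le]) (use assms genus_bounds in auto)

text \<open>
  For \<open>\<rho> = p + 1\<close> this is the decay at \<open>0\<close> that makes the integral over \<open>t \<le> 1\<close>
  holomorphic for \<open>Re s < p + 1\<close>.
\<close>

lemma norm_log_product_ray_le:
  assumes "\<alpha> < \<rho>" "\<rho> \<le> real genus + 1"
  shows "\<exists>K. \<forall>t>0. norm (log_product (of_real t * cis \<Psi>)) \<le> K * t powr \<rho>"
proof (intro exI allI impI)
  fix t :: real assume t: "t > 0"
  let ?f = "\<lambda>n. norm (b n) powr \<rho> / (cone_const * \<rho>) * t powr \<rho>"
  have f: "summable ?f" using summable_norm_b_powr[OF assms(1)] by (intro summable_mult2 summable_divide)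
  note le = norm_log_weierstrass_b_le[OF t assms]
  have s: "summable (\<lambda>n. norm (log_weierstrass genus (of_real t * b n)))"
    by (rule summable_comparison_test'[OF f]) (use le in simp)
  have "norm (log_product (of_real t * cis \<Psi>)) \<le> (\<Sum>n. norm (log_weierstrass genus (of_real t * b n)))"
    unfolding log_product_ray by (rule summable_norm[OF s])
  also have "\<dots> \<le> suminf ?f" by (rule suminf_le[OF le s f])
  also have "\<dots> = (\<Sum>n. norm (b n) powr \<rho> / (cone_const * \<rho>)) * t powr \<rho>"
    using summable_norm_b_powr[OF assms(1)] by (intro suminf_mult2[symmetric] summable_divide)
  finally show "norm (log_product (of_real t * cis \<Psi>)) \<le> (\<Sum>n. norm (b n) powr \<rho> / (cone_const * \<rho>)) * t powr \<rho>" .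
qed

text \<open>
  The principal logarithm of \<open>- b n = exp (\<i> (\<Psi> - \<pi>)) / a (n + 1)\<close> has imaginary part \<open>\<Psi> - \<pi> - \<theta>\<close>, where
  \<open>\<theta>\<close> is the argument of \<open>a (n + 1)\<close> in \<open>(\<Psi> - 2 \<pi>, \<Psi>]\<close>. The value \<open>\<theta> = \<Psi>\<close> would place \<open>b n\<close> on the
  positive axis.
\<close>

lemma Ln_minus_b: "Ln (- b n) = \<i> * of_real (\<Psi> - pi) - ln_near (\<Psi> - pi) (a (Suc n))"
proof (rule Ln_unique)
  let ?z = "\<i> * of_real (\<Psi> - pi) - ln_near (\<Psi> - pi) (a (Suc n))"
  have "exp (\<i> * of_real (\<Psi> - pi)) = - cis \<Psi>"
    unfolding cis_conv_exp[symmetric] by (simp add: complex_eq_iff cos_diff sin_diff)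
  thus e: "exp ?z = - b n"
    using exp_ln_near[OF a_nonzero] by (simp add: exp_diff b_def)
  have im: "Im ?z = \<Psi> - pi - arg_near (\<Psi> - pi) (a (Suc n))" by (simp add: ln_near_def)
  have bd: "-pi \<le> Im ?z" "Im ?z < pi"
    using arg_near_bounds[where c = "\<Psi> - pi" and z = "a (Suc n)"] unfolding im by auto
  thus "Im ?z \<le> pi" by simp
  have "Im ?z \<noteq> -pi"
  proof
    assume "Im ?z = -pi"
    hence "- b n = - of_real (exp (Re ?z))"
      using e exp_eq_polar[of ?z] by (simp add: cis.code complex_eq_iff)
    hence "b n \<in> \<real>\<^sub>\<ge>\<^sub>0" by simp
    thus False using b_notin_nonneg_Reals by blast
  qed
  thus "-pi < Im ?z" using bd by linarith
qed

lemma minus_b_powr: "(- b n) powr s = exp (\<i> * of_real (\<Psi> - pi) * s) * powr_near (\<Psi> - pi) (a (Suc n)) (- s)"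
proof -
  have "(- b n) powr s = exp (s * Ln (- b n))" using b_nonzero by (simp add: powr_def)
  thus ?thesis unfolding Ln_minus_b powr_near_def by (simp add: exp_add[symmetric] algebra_simps)
qed

text \<open>
  Sum of the transforms of the single factors at \<open>w = - b n\<close>. Sum and integral may be exchanged
  since the norms are bounded by \<open>\<bar>b n\<bar>^(p + 1)\<close> times an integrable function on \<open>t \<le> 1\<close> and by
  \<open>\<bar>b n\<bar>^\<rho>\<close> times one on \<open>t > 1\<close>, and both powers of \<open>\<bar>b n\<bar>\<close> are summable.
\<close>

lemma mellin_log_product_ray:
  assumes r: "\<alpha> < r" "r < real genus + 1"
  shows "(LINT t:{0<..}|lborel. of_real t powr (- of_real r - 1) * log_product (of_real t * cis \<Psi>)) =
    of_real (pi / (r * sin (pi * r))) * exp (\<i> * of_real (\<Psi> - pi) * of_real r) * zeta_series a \<Psi> (of_real r)"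
proof -
  define \<rho> where "\<rho> = (\<alpha> + r) / 2"
  have \<rho>: "\<alpha> < \<rho>" "\<rho> < r" "\<rho> \<le> real genus + 1" "\<rho> > 0" using r alpha_nonneg by (auto simp: \<rho>_def)
  define P where "P = real genus + 1"
  have P: "\<alpha> < P" "P \<le> real genus + 1" "r < P" "P > 0" using r genus_bounds alpha_nonneg by (auto simp: P_def)
  define f where "f n t = indicator {0<..} t *\<^sub>R (of_real t powr (- of_real r - 1) * log_weierstrass genus (of_real t * b n))" for n and t :: real
  define C where "C n \<rho> = norm (b n) powr \<rho> / (cone_const * \<rho>)" for n \<rho>
  define g where "g n t = C n P * (indicator {0<..1} t *\<^sub>R t powr (P - r - 1)) + C n \<rho> * (indicator {1<..} t *\<^sub>R t powr (\<rho> - r - 1))" for n and t :: real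
  define A1 where "A1 = (LINT t|lborel. indicator {0<..1} t *\<^sub>R t powr (P - r - 1))"
  define A2 where "A2 = (LINT t|lborel. indicator {1<..} t *\<^sub>R t powr (\<rho> - r - 1))"
  have i1: "integrable lborel (\<lambda>t. indicator {0<..1} t *\<^sub>R t powr (P - r - 1))"
    using set_integrable_powr_Ioc[of "P - r - 1"] P unfolding set_integrable_def by simp
  have i2: "integrable lborel (\<lambda>t. indicator {1<..} t *\<^sub>R t powr (\<rho> - r - 1))"
    using set_integrable_powr_Ioi[of "\<rho> - r - 1"] \<rho> unfolding set_integrable_def by simp
  have gi: "integrable lborel (g n)" for n
    unfolding g_def using i1 i2 by (intro Bochner_Integration.integrable_add integrable_mult_right)
  have gI: "integral\<^sup>L lborel (g n) = C n P * A1 + C n \<rho> * A2" for n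
    unfolding g_def A1_def A2_def using i1 i2
    by (subst Bochner_Integration.integral_add) (auto intro!: integrable_mult_right)
  have bnd: "norm (f n t) \<le> g n t" for n t
  proof (cases "t > 0")
    case True
    have nn: "norm (of_real t powr (- of_real r - 1) :: complex) = t powr (- r - 1)"
      using True by (simp add: norm_of_real_powr)
    have *: "norm (f n t) \<le> C n \<rho> * t powr (\<rho> - r - 1)" if "\<alpha> < \<rho>" "\<rho> \<le> real genus + 1" for \<rho>
    proof -
      have "norm (f n t) = t powr (- r - 1) * norm (log_weierstrass genus (of_real t * b n))"
        using True by (simp add: f_def norm_mult nn)
      also have "\<dots> \<le> t powr (- r - 1) * (C n \<rho> * t powr \<rho>)"
        unfolding C_def by (intro mult_left_mono norm_log_weierstrass_b_le True that) auto
      also have "\<dots> = C n \<rho> * (t powr (- r - 1) * t powr \<rho>)" by simp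
      also have "\<dots> = C n \<rho> * t powr (\<rho> - r - 1)"
        by (subst powr_add[symmetric]) (simp add: algebra_simps)
      finally show ?thesis .
    qed
    show ?thesis
    proof (cases "t \<le> 1")
      case True
      thus ?thesis using *[OF P(1,2)] \<open>t > 0\<close> by (simp add: g_def)
    next
      case False
      thus ?thesis using *[OF \<rho>(1,3)] \<open>t > 0\<close> by (simp add: g_def)
    qed
  qed (simp add: f_def g_def)
  have meas: "f n \<in> borel_measurable lborel" for n
    unfolding f_def[abs_def]
    by (rule borel_measurable_mellin[OF continuous_on_log_weierstrass_ray[OF b_notin_nonneg_Reals]]) auto
  have fi: "integrable lborel (f n)" for n
    by (rule Bochner_Integration.integrable_bound[OF gi meas])
       (use bnd in \<open>auto intro!: AE_I2 order.trans[OF bnd] abs_ge_self\<close>)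
  have gs: "summable (\<lambda>n. C n P * A1 + C n \<rho> * A2)"
    unfolding C_def using summable_norm_b_powr[OF P(1)] summable_norm_b_powr[OF \<rho>(1)]
    by (intro summable_add summable_mult2 summable_divide)
  have sI: "summable (\<lambda>n. LINT t|lborel. norm (f n t))"
  proof (rule summable_comparison_test'[OF gs])
    fix n :: nat
    have "(LINT t|lborel. norm (f n t)) \<le> integral\<^sup>L lborel (g n)"
      using fi gi bnd by (intro integral_mono) auto
    thus "norm (LINT t|lborel. norm (f n t)) \<le> C n P * A1 + C n \<rho> * A2"
      by (simp add: gI)
  qed
  have sAE: "summable (\<lambda>n. norm (f n t))" for t
  proof (cases "t > 0")
    case True
    have "summable (\<lambda>n. g n t)"
      unfolding g_def C_def using summable_norm_b_powr[OF P(1)] summable_norm_b_powr[OF \<rho>(1)]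
      by (intro summable_add summable_mult2 summable_divide)
    thus ?thesis by (rule summable_comparison_test') (use bnd in simp)
  qed (simp add: f_def)
  have "(LINT t:{0<..}|lborel. of_real t powr (- of_real r - 1) * log_product (of_real t * cis \<Psi>)) =
        (LINT t|lborel. (\<Sum>n. f n t))"
    unfolding set_lebesgue_integral_def
  proof (rule Bochner_Integration.integral_cong[OF refl])
    fix t :: real
    show "indicator {0<..} t *\<^sub>R (of_real t powr (- of_real r - 1) * log_product (of_real t * cis \<Psi>)) = (\<Sum>n. f n t)"
      using suminf_mult[OF summable_log_weierstrass_ray[of t], of "of_real t powr (- of_real r - 1)"]
      by (cases "t > 0") (simp_all add: f_def log_product_ray)
  qed
  also have "\<dots> = (\<Sum>n. integral\<^sup>L lborel (f n))"
    by (rule integral_suminf) (use fi sI sAE in auto)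
  also have "\<dots> = (\<Sum>n. (of_real (pi / (r * sin (pi * r))) * exp (\<i> * of_real (\<Psi> - pi) * of_real r)) *
                        powr_near (\<Psi> - pi) (a (Suc n)) (- of_real r))"
  proof (rule suminf_cong)
    fix n
    have "- b n \<notin> \<real>\<^sub>\<le>\<^sub>0" using b_notin_nonneg_Reals[of n] by simp
    from mellin_log_weierstrass[OF _ r(2) this]
    have "integral\<^sup>L lborel (f n) = of_real (pi / (r * sin (pi * r))) * (- b n) powr of_real r"
      using r genus_bounds by (simp add: f_def[abs_def] set_lebesgue_integral_def)
    thus "integral\<^sup>L lborel (f n) = (of_real (pi / (r * sin (pi * r))) * exp (\<i> * of_real (\<Psi> - pi) * of_real r)) *
                        powr_near (\<Psi> - pi) (a (Suc n)) (- of_real r)"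
      by (simp only: minus_b_powr mult.assoc)
  qed
  also have "\<dots> = of_real (pi / (r * sin (pi * r))) * exp (\<i> * of_real (\<Psi> - pi) * of_real r) * zeta_series a \<Psi> (of_real r)"
    unfolding zeta_series_def
    by (rule suminf_mult[OF summable_norm_cancel[OF summable_zeta_series]]) (use r in auto)
  finally show ?thesis .
qed

section \<open>The continued zeta function and its value at zero\<close>

text \<open>
  Here the expansion of the logarithm along the ray is abstract: its exponents are at most \<open>\<alpha>\<close> and
  its error exponent \<open>\<sigma>\<close> is negative. The terms of the given expansion of \<open>ln F\<close> and those of the
  polynomial \<open>C + \<omega>\<close> are then treated alike.
\<close>

context
  fixes J :: "'i set" and \<beta> :: "'i \<Rightarrow> real" and A B :: "'i \<Rightarrow> complex"
    and R :: "real \<Rightarrow> complex" and \<sigma> K' :: real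
  assumes J: "finite J" and \<beta>: "\<And>j. j \<in> J \<Longrightarrow> \<beta> j \<le> \<alpha>" and \<sigma>: "\<sigma> < 0"
    and R: "continuous_on {0<..} R" and R1: "\<And>t. 1 < t \<Longrightarrow> norm (R t) \<le> K' * t powr \<sigma>"
    and expansion: "\<And>t. 1 < t \<Longrightarrow> log_product (of_real t * cis \<Psi>) =
           R t + (\<Sum>j\<in>J. of_real (t powr \<beta> j) * (A j + B j * of_real (ln t)))"
begin

definition regular_part :: "complex \<Rightarrow> complex" where
  "regular_part s = (LINT t:{0<..1}|lborel. of_real t powr (-s-1) * log_product (of_real t * cis \<Psi>)) +
                    (LINT t:{1<..}|lborel. of_real t powr (-s-1) * R t)"

definition continued_zeta :: "complex \<Rightarrow> complex" where
  "continued_zeta s = s * sin (of_real pi * s) / of_real pi * exp (- (\<i> * of_real (\<Psi> - pi)) * s) *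
     mellin_continuation (\<lambda>t. log_product (of_real t * cis \<Psi>)) R J \<beta> A B s"

lemma mellin_continuation_eq:
  "mellin_continuation (\<lambda>t. log_product (of_real t * cis \<Psi>)) R J \<beta> A B s =
     regular_part s + (\<Sum>j\<in>J. A j / (s - of_real (\<beta> j)) + B j / (s - of_real (\<beta> j))\<^sup>2)"
  by (simp add: mellin_continuation_def regular_part_def)

lemma regular_part_holomorphic: "regular_part holomorphic_on {s. \<sigma> < Re s \<and> Re s < real genus + 1}"
proof -
  obtain K where K: "\<And>t. t > 0 \<Longrightarrow> norm (log_product (of_real t * cis \<Psi>)) \<le> K * t powr (real genus + 1)"
    using norm_log_product_ray_le[of "real genus + 1"] genus_bounds by auto
  show ?thesis
    unfolding regular_part_def
    by (intro holomorphic_on_add holomorphic_on_subset[OF holomorphic_mellin_0[OF continuous_on_log_product_ray K]]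
          holomorphic_on_subset[OF holomorphic_mellin_inf[OF R R1]]) auto
qed

text \<open>
  The strip \<open>\<alpha> < r < p + 1\<close> lies between the consecutive integers \<open>p\<close> and \<open>p + 1\<close>, so that
  \<open>sin (\<pi> r)\<close> does not vanish and may be cancelled.
\<close>

lemma continued_zeta_eq_real:
  assumes r: "\<alpha> < r" "r < real genus + 1"
  shows "continued_zeta (of_real r) = zeta_series a \<Psi> (of_real r)"
proof -
  obtain K where K: "\<And>t. t > 0 \<Longrightarrow> norm (log_product (of_real t * cis \<Psi>)) \<le> K * t powr (real genus + 1)"
    using norm_log_product_ray_le[of "real genus + 1"] genus_bounds by auto
  have "mellin_continuation (\<lambda>t. log_product (of_real t * cis \<Psi>)) R J \<beta> A B (of_real r) =
     (LINT t:{0<..}|lborel. of_real t powr (- of_real r - 1) * log_product (of_real t * cis \<Psi>))"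
    by (rule mellin_eq_mellin_continuation[OF continuous_on_log_product_ray K R R1 J expansion, symmetric])
       (use r \<sigma> \<beta> alpha_nonneg in \<open>auto intro: le_less_trans\<close>)
  also have "\<dots> = of_real (pi / (r * sin (pi * r))) * exp (\<i> * of_real (\<Psi> - pi) * of_real r) * zeta_series a \<Psi> (of_real r)"
    by (rule mellin_log_product_ray[OF r])
  finally have M: "mellin_continuation (\<lambda>t. log_product (of_real t * cis \<Psi>)) R J \<beta> A B (of_real r) =
     of_real (pi / (r * sin (pi * r))) * exp (\<i> * of_real (\<Psi> - pi) * of_real r) * zeta_series a \<Psi> (of_real r)" .
  have "r > 0" using r alpha_nonneg by simp
  have "sin (pi * r) \<noteq> 0"
  proof
    assume "sin (pi * r) = 0"
    then obtain k :: int where "pi * r = of_int k * pi" using sin_zero_iff_int2 by blast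
    hence k: "r = of_int k" by simp
    have "int genus < k" "k < int genus + 1" using r genus_bounds unfolding k by linarith+
    thus False by simp
  qed
  have s: "sin (of_real pi * of_real r :: complex) = of_real (sin (pi * r))"
    by (simp flip: of_real_mult sin_of_real)
  have "continued_zeta (of_real r) =
     (of_real r * of_real (sin (pi * r)) / of_real pi * of_real (pi / (r * sin (pi * r)))) *
     (exp (- (\<i> * of_real (\<Psi> - pi)) * of_real r) * exp (\<i> * of_real (\<Psi> - pi) * of_real r)) *
     zeta_series a \<Psi> (of_real r)"
    unfolding continued_zeta_def M s by (simp only: mult.assoc mult.left_commute mult.commute)
  also have "exp (- (\<i> * of_real (\<Psi> - pi)) * of_real r) * exp (\<i> * of_real (\<Psi> - pi) * of_real r) = 1"
    by (simp add: exp_add[symmetric])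
  also have "of_real r * of_real (sin (pi * r)) / of_real pi * of_real (pi / (r * sin (pi * r))) = (1 :: complex)"
    using \<open>r > 0\<close> \<open>sin (pi * r) \<noteq> 0\<close> by simp
  finally show ?thesis by simp
qed

lemma continued_zeta_eq:
  assumes s: "\<alpha> < Re s" "Re s < real genus + 1"
  shows "continued_zeta s = zeta_series a \<Psi> s"
proof (rule holomorphic_eq_if_eq_on_real_interval[where f = continued_zeta and g = "zeta_series a \<Psi>"
        and S = "{s. \<alpha> < Re s} \<inter> {s. Re s < real genus + 1}" and z = s and a = \<alpha> and b = "real genus + 1"])
  let ?S = "{s. \<alpha> < Re s} \<inter> {s. Re s < real genus + 1}"
  show "continued_zeta holomorphic_on ?S"
    unfolding continued_zeta_def mellin_continuation_eq
    using \<sigma> alpha_nonneg \<beta>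
    by (intro holomorphic_intros holomorphic_on_subset[OF regular_part_holomorphic]) fastforce+
  show "zeta_series a \<Psi> holomorphic_on ?S"
    by (rule holomorphic_on_subset[OF zeta_series_holomorphic]) auto
  show "open ?S" by (intro open_Int open_halfspace_Re_gt open_halfspace_Re_lt)
  show "connected ?S"
    by (intro convex_connected convex_Int convex_halfspace_Re_gt convex_halfspace_Re_lt)
qed (use s genus_bounds continued_zeta_eq_real in auto)

text \<open>
  The formula for \<^term>\<open>continued_zeta\<close> stops at \<open>Re s = p + 1\<close>, where the integral over
  \<open>t < 1\<close> diverges; from there on the series takes over.
\<close>

definition zeta_extension :: "complex \<Rightarrow> complex" where
  "zeta_extension s = (if \<alpha> < Re s then zeta_series a \<Psi> s else continued_zeta s)"

lemma zeta_extension_eq_continued_zeta: "Re s < real genus + 1 \<Longrightarrow> zeta_extension s = continued_zeta s"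
  by (simp add: zeta_extension_def continued_zeta_eq)

lemma zeta_extension_analytic: "zeta_extension analytic_on {s. \<alpha> < Re s}"
proof -
  have "zeta_extension holomorphic_on {s. \<alpha> < Re s}"
    using zeta_series_holomorphic by (rule holomorphic_transform) (simp add: zeta_extension_def)
  thus ?thesis by (simp add: analytic_on_open open_halfspace_Re_gt)
qed

lemma zeta_extension_meromorphic: "zeta_extension meromorphic_on {s. \<sigma> < Re s}"
proof -
  let ?S = "{s. \<sigma> < Re s \<and> Re s < real genus + 1}"
  have S: "open ?S"
    using open_Int[OF open_halfspace_Re_gt open_halfspace_Re_lt, of \<sigma> "real genus + 1"] by (simp add: Collect_conj_eq)
  have reg: "regular_part meromorphic_on ?S"
    using regular_part_holomorphic S by (simp add: analytic_on_open analytic_on_imp_meromorphic_on)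
  have factor: "(\<lambda>s. s * sin (of_real pi * s) / of_real pi * exp (- (\<i> * of_real (\<Psi> - pi)) * s)) meromorphic_on ?S"
    by (intro analytic_on_imp_meromorphic_on analytic_intros) auto
  have "continued_zeta meromorphic_on ?S"
    unfolding continued_zeta_def mellin_continuation_eq
    by (rule meromorphic_on_mult[OF factor]) (intro meromorphic_intros reg)
  also have "?this \<longleftrightarrow> zeta_extension meromorphic_on ?S"
  proof (rule meromorphic_on_cong)
    fix s assume "s \<in> ?S"
    hence "\<forall>\<^sub>F w in at s. w \<in> ?S" using S by (intro eventually_at_in_open') auto
    thus "\<forall>\<^sub>F w in at s. continued_zeta w = zeta_extension w"
      by eventually_elim (simp add: zeta_extension_eq_continued_zeta)
  qed simp
  finally have "zeta_extension meromorphic_on (?S \<union> {s. \<alpha> < Re s})"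
    by (rule meromorphic_on_Un[OF _ analytic_on_imp_meromorphic_on[OF zeta_extension_analytic]])
  moreover have "Re s < real genus + 1" if "\<not> \<alpha> < Re s" for s
    using that genus_bounds by linarith
  ultimately show ?thesis by (elim meromorphic_on_subset) auto
qed

lemma zeta_continuation_exists: "\<exists>Z. zeta_continuation a \<alpha> \<Psi> \<sigma> Z"
proof
  have "remove_sings zeta_extension s = zeta_series a \<Psi> s" if "\<alpha> < Re s" for s
  proof -
    have "zeta_extension analytic_on {s}"
      using zeta_extension_analytic by (rule analytic_on_subset) (use that in auto)
    thus ?thesis using that by (simp add: zeta_extension_def)
  qed
  thus "zeta_continuation a \<alpha> \<Psi> \<sigma> (remove_sings zeta_extension)"
    unfolding zeta_continuation_def
    using remove_sings_nicely_meromorphic[OF zeta_extension_meromorphic] by blast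
qed

lemma zeta_continuation_eventually_eq:
  assumes "zeta_continuation a \<alpha> \<Psi> \<sigma> Z"
  shows "\<forall>\<^sub>F s in at 0. Z s = zeta_extension s"
proof (rule meromorphic_eventually_eq)
  show "Z meromorphic_on {s. \<sigma> < Re s}"
    using assms by (simp add: zeta_continuation_def nicely_meromorphic_on_def)
  have "\<forall>\<^sub>F s in at (of_real (\<alpha> + 1)). s \<in> {s. \<alpha> < Re s}"
    by (intro eventually_at_in_open' open_halfspace_Re_gt) auto
  thus "\<forall>\<^sub>F s in at (of_real (\<alpha> + 1)). Z s = zeta_extension s"
    by eventually_elim (use assms in \<open>simp add: zeta_continuation_def zeta_extension_def\<close>)
qed (use zeta_extension_meromorphic \<sigma> alpha_nonneg in
      \<open>auto simp: open_halfspace_Re_gt intro: convex_connected convex_halfspace_Re_gt\<close>)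

text \<open>
  Every continuation agrees near \<open>0\<close> with the same explicit function, which the double zero of
  the prefactor makes holomorphic at \<open>0\<close>. A nicely meromorphic function with a finite limit takes
  that limit as its value, so the agreement includes the point \<open>0\<close>.
\<close>

lemma zeta_continuation_at_0:
  assumes Z: "zeta_continuation a \<alpha> \<Psi> \<sigma> Z"
  defines "D \<equiv> \<lambda>X. \<Sum>j\<in>{j\<in>J. \<beta> j = 0}. X j"
  shows "Z analytic_on {0}" "Z 0 = D B" "deriv Z 0 = D A - \<i> * of_real (\<Psi> - pi) * D B"
proof -
  let ?S = "{s. \<sigma> < Re s} \<inter> {s. Re s < real genus + 1}"
  have S: "open ?S" by (intro open_Int open_halfspace_Re_gt open_halfspace_Re_lt)
  have "0 < real genus + 1" by linarith
  hence S0: "0 \<in> ?S" using \<sigma> by simp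
  have Q: "regular_part holomorphic_on ?S"
    using regular_part_holomorphic by (simp add: Collect_conj_eq)
  obtain g where g: "g holomorphic_on UNIV" "g 0 = 1" "deriv g 0 = 0"
    "\<And>s. sin (of_real pi * s) = of_real pi * s * g s" using sin_over_linear by blast
  obtain W where W: "W analytic_on {0}" "W 0 = D B" "deriv W 0 = D A - \<i> * of_real (\<Psi> - pi) * D B"
    and W': "\<forall>\<^sub>F s in at 0. W s = s\<^sup>2 * g s * exp (- (\<i> * of_real (\<Psi> - pi)) * s) *
       (regular_part s + (\<Sum>j\<in>J. A j / (s - of_real (\<beta> j)) + B j / (s - of_real (\<beta> j))\<^sup>2))"
    using double_pole_times_double_zero[OF J S S0 Q g(1-3), where \<beta> = \<beta> and A = A and B = B and c = "\<i> * of_real (\<Psi> - pi)"]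
    unfolding D_def by blast
  have "\<forall>\<^sub>F s in at 0. s \<in> ?S" using S S0 by (intro eventually_at_in_open')
  with zeta_continuation_eventually_eq[OF Z] W' have ev: "\<forall>\<^sub>F s in at 0. Z s = W s"
  proof eventually_elim
    case (elim s)
    have "Z s = continued_zeta s" using elim by (simp add: zeta_extension_eq_continued_zeta)
    also have "\<dots> = s * (of_real pi * s * g s) / of_real pi * exp (- (\<i> * of_real (\<Psi> - pi)) * s) *
       (regular_part s + (\<Sum>j\<in>J. A j / (s - of_real (\<beta> j)) + B j / (s - of_real (\<beta> j))\<^sup>2))"
      by (simp only: continued_zeta_def mellin_continuation_eq g(4))
    also have "s * (of_real pi * s * g s) / of_real pi = s\<^sup>2 * g s"
      by (simp add: power2_eq_square)
    finally show ?case using elim by simp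
  qed
  have "W \<midarrow>0\<rightarrow> W 0" using W(1) by (simp add: analytic_at_imp_isCont isContD)
  hence lim: "Z \<midarrow>0\<rightarrow> W 0" by (rule Lim_transform_eventually) (use ev in \<open>auto elim: eventually_mono\<close>)
  hence "\<not> is_pole Z 0"
    unfolding is_pole_def using not_tendsto_and_filterlim_at_infinity[OF at_neq_bot lim] by blast
  moreover have "0 \<in> {s. \<sigma> < Re s}" using \<sigma> by simp
  ultimately have "Z \<midarrow>0\<rightarrow> Z 0"
    using Z unfolding zeta_continuation_def nicely_meromorphic_on_def by blast
  hence Z0: "Z 0 = W 0" using lim by (rule LIM_unique)
  hence ev': "\<forall>\<^sub>F s in nhds 0. Z s = W s"
    using ev by (simp add: eventually_nhds_conv_at)
  show "Z analytic_on {0}" using W(1) analytic_at_cong[OF ev' refl] by simp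
  show "Z 0 = D B" using Z0 W(2) by simp
  show "deriv Z 0 = D A - \<i> * of_real (\<Psi> - pi) * D B"
    using deriv_cong_ev[OF ev' refl] W(3) by simp
qed

end

lemma ln_near_ray: "t > 0 \<Longrightarrow> ln_near \<Psi> (of_real t * cis \<Psi>) = of_real (ln t) + \<i> * of_real \<Psi>"
  by (subst ln_near_def, subst arg_near_unique[of _ \<Psi>])
     (auto simp: is_Arg_def norm_mult cis_conv_exp)

lemma powr_near_ray:
  assumes "t > 0"
  shows "powr_near \<Psi> (of_real t * cis \<Psi>) (of_real x) = of_real (t powr x) * exp (\<i> * of_real (\<Psi> * x))"
  unfolding powr_near_def ln_near_ray[OF assms]
  using assms by (simp add: powr_def exp_of_real[symmetric] exp_add[symmetric] algebra_simps)

end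

section \<open>The derivative of the zeta function at zero\<close>

theorem theorem3p5:
  fixes a :: "nat \<Rightarrow> complex" and F L :: "complex \<Rightarrow> complex"
    and d :: "nat \<Rightarrow> nat \<Rightarrow> complex" and N m :: nat
    and \<alpha> \<Psi> \<epsilon> \<delta> :: real
  assumes "admissible_sequence a \<alpha> \<Psi> \<epsilon>"
    and "minimal_characteristic_function a \<alpha> F"
    and "1 \<le> m" and "0 < \<delta>" and "real N / real m > \<alpha> - \<delta>"
    and "L holomorphic_on sector \<Psi> \<epsilon>"
    and "\<And>z. z \<in> sector \<Psi> \<epsilon> \<Longrightarrow> exp (L z) = F z"
    and "(\<lambda>z. L z - (\<Sum>j=0..N. \<Sum>k=0..1. d j k *
              powr_near \<Psi> z (of_real (\<alpha> - real j / real m)) * ln_near \<Psi> z ^ k))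
         \<in> o[inf at_infinity (principal (sector \<Psi> \<epsilon>))](\<lambda>z.
              powr_near \<Psi> z (of_real (\<alpha> - real N / real m - \<delta>)))"
  shows "\<exists>lnF0. (L \<longlongrightarrow> lnF0) (at 0 within sector \<Psi> \<epsilon>) \<and>
     (\<exists>Z. zeta_continuation a \<alpha> \<Psi> (\<alpha> - real N / real m - \<delta>) Z) \<and>
     (\<forall>Z. zeta_continuation a \<alpha> \<Psi> (\<alpha> - real N / real m - \<delta>) Z \<longrightarrow>
        Z analytic_on {0} \<and>
        ((\<forall>j\<le>N. \<alpha> - real j / real m \<noteq> 0) \<longrightarrow>
           deriv Z 0 = - lnF0 \<and>
           deriv Z 0 = \<i> * of_real pi * Z 0 - lnF0) \<and>
        (\<forall>j\<le>N. \<alpha> - real j / real m = 0 \<longrightarrow>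
           deriv Z 0 = \<i> * of_real pi * d j 1 + d j 0 - lnF0 \<and>
           deriv Z 0 = \<i> * of_real pi * Z 0 + d j 0 - lnF0))"
proof -
  interpret admissible a \<alpha> \<Psi> \<epsilon> by unfold_locales fact
  obtain \<omega> :: "complex poly" where deg: "degree \<omega> \<le> genus"
    and F: "F = (\<lambda>z. exp (poly \<omega> z) * canonical_product a \<alpha> z)"
    using assms(2) unfolding minimal_characteristic_function_def by blast
  obtain C where L: "\<And>z. z \<in> sector \<Psi> \<epsilon> \<Longrightarrow> L z = C + poly \<omega> z + log_product z"
    using log_branch_eq[OF F assms(6,7)] by blast
  define lnF0 where "lnF0 = C + coeff \<omega> 0"
  define \<sigma> where "\<sigma> = \<alpha> - real N / real m - \<delta>"
  have \<sigma>: "\<sigma> < 0" using assms(5) by (simp add: \<sigma>_def)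

  have lim: "(L \<longlongrightarrow> lnF0) (at 0 within sector \<Psi> \<epsilon>)"
  proof -
    have "(log_product \<longlongrightarrow> log_product 0) (at 0 within insert 0 (sector \<Psi> \<epsilon>))"
      using continuous_on_log_product unfolding continuous_on_def by blast
    hence "(log_product \<longlongrightarrow> 0) (at 0 within sector \<Psi> \<epsilon>)"
      unfolding log_product_0 by (rule tendsto_within_subset) auto
    hence "((\<lambda>z. C + poly \<omega> z + log_product z) \<longlongrightarrow> C + poly \<omega> 0 + 0) (at 0 within sector \<Psi> \<epsilon>)"
      by (intro tendsto_intros)
    moreover have "\<forall>\<^sub>F z in at 0 within sector \<Psi> \<epsilon>. C + poly \<omega> z + log_product z = L z"
      using L by (simp add: eventually_at_filter)
    ultimately have "(L \<longlongrightarrow> C + poly \<omega> 0 + 0) (at 0 within sector \<Psi> \<epsilon>)"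
      by (rule Lim_transform_eventually)
    thus ?thesis by (simp add: lnF0_def poly_0_coeff_0)
  qed

  \<comment> \<open>Exponents and coefficients of the expansion of \<^term>\<open>log_product\<close> along the ray: left indices are
    the terms of the expansion of \<open>L\<close>, where \<open>E j = exp (\<i> \<Psi> x j)\<close> and \<open>\<i> \<Psi>\<close> come from the argument \<open>\<Psi>\<close> of
    the points of the ray; right indices are the terms of \<open>- (C + \<omega>)\<close>.\<close>
  define x where "x j = \<alpha> - real j / real m" for j
  define E where "E j = exp (\<i> * of_real (\<Psi> * x j))" for j
  define J :: "(nat + nat) set" where "J = {..N} <+> {..genus}"
  define \<beta> :: "nat + nat \<Rightarrow> real" where "\<beta> = case_sum x real"
  define A :: "nat + nat \<Rightarrow> complex" where "A = case_sum (\<lambda>j. E j * (d j 0 + \<i> * of_real \<Psi> * d j 1))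
     (\<lambda>i. - ((if i = 0 then C else 0) + coeff \<omega> i) * cis \<Psi> ^ i)"
  define B :: "nat + nat \<Rightarrow> complex" where "B = case_sum (\<lambda>j. E j * d j 1) (\<lambda>_. 0)"
  define R where "R t = L (of_real t * cis \<Psi>) -
     (\<Sum>j\<le>N. of_real (t powr x j) * (A (Inl j) + B (Inl j) * of_real (ln t)))" for t
  have J: "finite J" by (simp add: J_def)
  have \<beta>: "\<beta> j \<le> \<alpha>" if "j \<in> J" for j
    using that genus_bounds by (auto simp: J_def \<beta>_def x_def)

  have expansion_ray: "(\<Sum>j=0..N. \<Sum>k=0..1. d j k * powr_near \<Psi> (of_real t * cis \<Psi>) (of_real (x j)) *
          ln_near \<Psi> (of_real t * cis \<Psi>) ^ k) =
       (\<Sum>j\<le>N. of_real (t powr x j) * (A (Inl j) + B (Inl j) * of_real (ln t)))" if "t > 0" for t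
    unfolding atLeast0AtMost powr_near_ray[OF that] ln_near_ray[OF that]
    by (intro sum.cong refl) (simp add: A_def B_def E_def algebra_simps)

  have expansion: "log_product (of_real t * cis \<Psi>) =
       R t + (\<Sum>j\<in>J. of_real (t powr \<beta> j) * (A j + B j * of_real (ln t)))" if "1 < t" for t
  proof -
    have t: "t > 0" using that by simp
    have const: "C = (\<Sum>i\<le>genus. (if i = 0 then C else 0) * (of_real t * cis \<Psi>) ^ i)"
      by (simp add: if_distrib[of "\<lambda>c. c * _"] cong: if_cong)
    have poly: "poly \<omega> (of_real t * cis \<Psi>) = (\<Sum>i\<le>genus. coeff \<omega> i * (of_real t * cis \<Psi>) ^ i)"
      unfolding poly_altdef using deg by (intro sum.mono_neutral_left) (auto simp: coeff_eq_0)
    have "C + poly \<omega> (of_real t * cis \<Psi>) =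
        (\<Sum>i\<le>genus. (if i = 0 then C else 0) * (of_real t * cis \<Psi>) ^ i) +
        (\<Sum>i\<le>genus. coeff \<omega> i * (of_real t * cis \<Psi>) ^ i)"
      by (rule arg_cong2[OF const poly])
    also have "\<dots> =
        (\<Sum>i\<le>genus. ((if i = 0 then C else 0) + coeff \<omega> i) * (of_real t * cis \<Psi>) ^ i)"
      unfolding sum.distrib[symmetric] by (intro sum.cong) (auto simp: algebra_simps)
    also have "\<dots> = - (\<Sum>i\<le>genus. of_real (t powr \<beta> (Inr i)) * (A (Inr i) + B (Inr i) * of_real (ln t)))"
      unfolding sum_negf[symmetric] using t
      by (intro sum.cong refl) (simp add: \<beta>_def A_def B_def powr_realpow power_mult_distrib algebra_simps)
    finally have "log_product (of_real t * cis \<Psi>) = L (of_real t * cis \<Psi>) +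
        (\<Sum>i\<le>genus. of_real (t powr \<beta> (Inr i)) * (A (Inr i) + B (Inr i) * of_real (ln t)))"
      using L[OF ray_in_sector[OF t]] by (simp add: algebra_simps)
    also have "\<dots> = R t + (\<Sum>j\<in>J. of_real (t powr \<beta> j) * (A j + B j * of_real (ln t)))"
      by (simp add: R_def J_def sum.Plus \<beta>_def o_def)
    finally show ?thesis .
  qed

  have R: "continuous_on {0<..} R"
    unfolding R_def
    by (intro continuous_intros continuous_on_compose2[OF holomorphic_on_imp_continuous_on[OF assms(6)]])
       (auto intro: ray_in_sector)

  obtain K where K: "\<And>t. 1 < t \<Longrightarrow> norm (R t) \<le> K * t powr \<sigma>"
  proof -
    from landau_o.smallD[OF assms(8), of 1]
    have "\<forall>\<^sub>F z in at_infinity. z \<in> sector \<Psi> \<epsilon> \<longrightarrow>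
        norm (L z - (\<Sum>j=0..N. \<Sum>k=0..1. d j k * powr_near \<Psi> z (of_real (x j)) * ln_near \<Psi> z ^ k))
          \<le> norm (powr_near \<Psi> z (of_real \<sigma>))"
      by (simp add: eventually_inf_principal x_def \<sigma>_def)
    then obtain T0 where T0: "\<And>z. norm z \<ge> T0 \<Longrightarrow> z \<in> sector \<Psi> \<epsilon> \<Longrightarrow>
        norm (L z - (\<Sum>j=0..N. \<Sum>k=0..1. d j k * powr_near \<Psi> z (of_real (x j)) * ln_near \<Psi> z ^ k))
          \<le> norm (powr_near \<Psi> z (of_real \<sigma>))"
      unfolding eventually_at_infinity by blast
    \<comment> \<open>beyond \<open>T\<close> the expansion gives the bound, and on \<open>[1, T]\<close> continuity does\<close>
    define T where "T = max 1 T0"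
    have far: "norm (R t) \<le> t powr \<sigma>" if "t \<ge> T" for t
    proof -
      have t: "t > 0" "norm (of_real t * cis \<Psi>) \<ge> T0" using that by (auto simp: T_def norm_mult)
      have "norm (R t) \<le> norm (powr_near \<Psi> (of_real t * cis \<Psi>) (of_real \<sigma>))"
        using T0[OF t(2) ray_in_sector[OF t(1)]] unfolding R_def expansion_ray[OF t(1), symmetric] .
      also have "\<dots> = t powr \<sigma>"
        unfolding powr_near_ray[OF t(1)] by (simp add: norm_mult)
      finally show ?thesis .
    qed
    have "compact (R ` {1..T})"
      by (intro compact_continuous_image continuous_on_subset[OF R]) auto
    then obtain Q where Q: "Q > 0" "\<And>t. t \<in> {1..T} \<Longrightarrow> norm (R t) \<le> Q"
      by (metis bounded_pos compact_imp_bounded image_eqI)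
    have "norm (R t) \<le> max 1 (Q / T powr \<sigma>) * t powr \<sigma>" if "1 < t" for t
    proof (cases "t \<ge> T")
      case True
      have "norm (R t) \<le> 1 * t powr \<sigma>" using far[OF True] by simp
      also have "\<dots> \<le> max 1 (Q / T powr \<sigma>) * t powr \<sigma>" by (intro mult_right_mono) auto
      finally show ?thesis .
    next
      case False
      have Tp: "T powr \<sigma> > 0" by (simp add: T_def)
      have "norm (R t) \<le> Q" using Q(2)[of t] that False by simp
      also have "\<dots> = Q / T powr \<sigma> * T powr \<sigma>" using Tp by simp
      also have "\<dots> \<le> Q / T powr \<sigma> * t powr \<sigma>"
        using that False \<sigma> Q Tp by (intro mult_left_mono powr_mono2') auto
      also have "\<dots> \<le> max 1 (Q / T powr \<sigma>) * t powr \<sigma>" by (intro mult_right_mono) auto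
      finally show ?thesis .
    qed
    thus ?thesis by (rule that)
  qed

  note context_facts = J \<beta> \<sigma> R K expansion
  \<comment> \<open>at most one index of the expansion has exponent \<open>0\<close>; the right index \<open>0\<close> always does\<close>
  define zeros where "zeros = {j. j \<le> N \<and> x j = 0}"
  have fz: "finite zeros" by (simp add: zeros_def)
  have zero_exponents: "{j \<in> J. \<beta> j = 0} = Inl ` zeros \<union> {Inr 0}"
    by (auto simp: J_def \<beta>_def zeros_def Plus_def)
  have DA: "(\<Sum>j\<in>{j \<in> J. \<beta> j = 0}. A j) = (\<Sum>j\<in>zeros. d j 0 + \<i> * of_real \<Psi> * d j 1) - lnF0"
  proof -
    have "(\<Sum>j\<in>{j \<in> J. \<beta> j = 0}. A j) = (\<Sum>j\<in>zeros. A (Inl j)) + A (Inr 0)"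
      unfolding zero_exponents using fz by (subst sum.union_disjoint) (auto simp: sum.reindex o_def)
    also have "(\<Sum>j\<in>zeros. A (Inl j)) = (\<Sum>j\<in>zeros. d j 0 + \<i> * of_real \<Psi> * d j 1)"
      by (intro sum.cong) (auto simp: A_def E_def zeros_def)
    finally show ?thesis by (simp add: A_def lnF0_def)
  qed
  have DB: "(\<Sum>j\<in>{j \<in> J. \<beta> j = 0}. B j) = (\<Sum>j\<in>zeros. d j 1)"
  proof -
    have "(\<Sum>j\<in>{j \<in> J. \<beta> j = 0}. B j) = (\<Sum>j\<in>zeros. B (Inl j)) + B (Inr 0)"
      unfolding zero_exponents using fz by (subst sum.union_disjoint) (auto simp: sum.reindex o_def)
    also have "(\<Sum>j\<in>zeros. B (Inl j)) = (\<Sum>j\<in>zeros. d j 1)"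
      by (intro sum.cong) (auto simp: B_def E_def zeros_def)
    finally show ?thesis by (simp add: B_def)
  qed
  have at_0: "Z analytic_on {0}" "Z 0 = (\<Sum>j\<in>zeros. d j 1)"
    "deriv Z 0 = (\<Sum>j\<in>zeros. d j 0 + \<i> * of_real \<Psi> * d j 1) - lnF0 - \<i> * of_real (\<Psi> - pi) * (\<Sum>j\<in>zeros. d j 1)"
    if "zeta_continuation a \<alpha> \<Psi> \<sigma> Z" for Z
    using zeta_continuation_at_0[OF context_facts that] unfolding DA DB by blast+

  have no_zero: "deriv Z 0 = - lnF0 \<and> deriv Z 0 = \<i> * of_real pi * Z 0 - lnF0"
    if "zeta_continuation a \<alpha> \<Psi> \<sigma> Z" "\<forall>j\<le>N. x j \<noteq> 0" for Z
  proof -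
    have "zeros = {}" using that(2) by (auto simp: zeros_def)
    thus ?thesis using at_0(2,3)[OF that(1)] by simp
  qed
  have one_zero: "deriv Z 0 = \<i> * of_real pi * d j 1 + d j 0 - lnF0 \<and>
      deriv Z 0 = \<i> * of_real pi * Z 0 + d j 0 - lnF0"
    if "zeta_continuation a \<alpha> \<Psi> \<sigma> Z" "j \<le> N" "x j = 0" for Z j
  proof -
    have "zeros = {j}" using that(2,3) \<open>1 \<le> m\<close> by (auto simp: zeros_def x_def)
    thus ?thesis using at_0(2,3)[OF that(1)] by (simp add: algebra_simps)
  qed
  show ?thesis
    unfolding \<sigma>_def[symmetric] unfolding x_def[symmetric]
    using lim zeta_continuation_exists[OF context_facts] at_0(1) no_zero one_zero
    by (intro exI[of _ lnF0]) blast
qed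

end
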